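(* Let $f:\mathbb{R}\to\mathbb{C}$ be a locally Lipschitz function, $1<p<\infty$, $n\in\mathbb{N}$. Then the following assertions hold. (i) If $f$ is $n$ times Gâteaux $\mathcal{S}^p$-differentiable at every bounded self-adjoint operator, then $f$ is $n$ times differentiable on $\mathbb{R}$ and $f',\ldots,f^{(n)}$ are bounded on compact subsets of $\mathbb{R}$. Moreover, if $f\in\mathrm{Lip}(\mathbb{R})$ is $n$ times Gâteaux $\mathcal{S}^p$-differentiable at every self-adjoint operator, then $f',\ldots,f^{(n)}$ are bounded on $\mathbb{R}$. (ii) If $f$ is $n$ times Fréchet $\mathcal{S}^p$-differentiable at every bounded self-adjoint operator, then $f\in C^n(\mathbb{R})$.
   Context: **Notation.** $\mathcal{H}$ is a fixed infinite-dimensional separable Hilbert space; self-adjoint operators are defined on $\mathcal{H}$ or on a dense subspace of $\mathcal{H}$ (possibly unbounded). $\mathcal{S}^p$ is the Schatten–von Neumann class on $\mathcal{H}$ with norm $\|\cdot\|_p$, and $\mathcal{S}^p_{sa}$ is its subset of self-adjoint elements. $\mathcal{B}_n(X_1\times\cdots\times X_n,Y)$ is the space of bounded $n$-linear operators between Banach spaces. $\mathrm{Lip}(\mathbb{R})$ is the space of Lipschitz functions on $\mathbb{R}$ and $C^n(\mathbb{R})$ the space of $n$ times continuously differentiable functions. Let $A=A^*$, and suppose either $f\in\mathrm{Lip}(\mathbb{R})$, or $A$ is bounded and $f$ is locally Lipschitz. For $X\in\mathcal{S}^p_{sa}$, $1<p<\infty$, the operator $f(A+X)-f(A)$ then belongs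 to $\mathcal{S}^p$ (known). **Gâteaux differentiability.** Let $\varphi_{A,X,f,p}:\mathbb{R}\to\mathcal{S}^p$, $\varphi_{A,X,f,p}(t)=f(A+tX)-f(A)$. The function $f$ is $n$ times Gâteaux $\mathcal{S}^p$-differentiable at $A$ if, for every $X\in\mathcal{S}^p_{sa}$, $\varphi_{A,X,f,p}$ is $n$ times differentiable at $0$, and for every $k=1,\ldots,n$ the map $X\mapsto\varphi^{(k)}_{A,X,f,p}(0)$, $\mathcal{S}^p_{sa}\to\mathcal{S}^p$, is a bounded homogeneous transformation of order $k$ (i.e. homogeneous of degree $k$ and bounded in norm by a constant times $\|X\|_p^k$). **Fréchet differentiability.** An $\mathcal{S}^p_{sa}$-neighborhood of $A$ is a set $\{A+X: X\in\mathcal{V}\}$ with $\mathcal{V}\subset\mathcal{S}^p_{sa}$ a neighborhood of $0$. The function $f$ is $n$ times Fréchet $\mathcal{S}^p$-differentiable at $A$ if it is $n-1$ times Fréchet $\mathcal{S}^p$-differentiable in an $\mathcal{S}^p_{sa}$-neighborhood of $A$ (no condition if $n=1$) and there is $D_p^nf(A)\in\mathcal{B}_n(\mathcal{S}^p\times\cdots\times\mathcal{S}^p,\mathcal{S}^p)$ such that $$\|(D_p^{n-1}f(A+X)-D_p^{n-1}f(A))(X_1,\ldots,X_{n-1})-D_p^nf(A)(X_1,\ldots,X_{n-1},X)\|_p=o(\|X\|_p)\|X_1\|_p\cdots\|X_{n-1}\|_p$$ as $\|X\|_p\to0$, $X\in\mathcal{S}^p_{sa}$, uniformly for all $X_1,\ldots,X_{n-1}\in\mathcal{S}^p$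 (for $n=1$, $D_p^0f(A+X)-D_p^0f(A)$ means $f(A+X)-f(A)$). *)

theory Defs
  imports "HOL-Analysis.Analysis"
begin

section \<open>Complex Hilbert spaces\<close>

text \<open>The library has only real inner product spaces. The real structure below is the restriction
  of the complex one, so norm, topology and completeness are those of the library. The complex inner
  product is linear in its first argument.\<close>

class complex_hilbert_space = real_inner + complete_space +
  fixes scaleC :: "complex \<Rightarrow> 'a \<Rightarrow> 'a" (infixr "*\<^sub>C" 75)
    and cinner :: "'a \<Rightarrow> 'a \<Rightarrow> complex"
  assumes scaleC_add_right: "c *\<^sub>C (x + y) = c *\<^sub>C x + c *\<^sub>C y"
    and scaleC_add_left: "(c + d) *\<^sub>C x = c *\<^sub>C x + d *\<^sub>C x"
    and scaleC_scaleC: "c *\<^sub>C d *\<^sub>C x = (c * d) *\<^sub>C x"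
    and scaleC_of_real: "complex_of_real r *\<^sub>C x = r *\<^sub>R x"
    and cinner_add_left: "cinner (x + y) z = cinner x z + cinner y z"
    and cinner_scaleC_left: "cinner (c *\<^sub>C x) y = c * cinner x y"
    and cinner_commute: "cinner x y = cnj (cinner y x)"
    and inner_eq_Re_cinner: "inner x y = Re (cinner x y)"

global_interpretation complex_vector:
  vector_space "scaleC :: complex \<Rightarrow> 'a \<Rightarrow> 'a::complex_hilbert_space"
proof
  show "1 *\<^sub>C x = x" for x :: 'a
    using scaleC_of_real[of 1 x] by simp
qed (simp_all add: scaleC_add_right scaleC_add_left scaleC_scaleC)

lemma cinner_self: "cinner x x = complex_of_real ((norm x)\<^sup>2)"
  for x :: "'a::complex_hilbert_space"
proof (rule complex_eqI)
  show "Re (cinner x x) = Re (complex_of_real ((norm x)\<^sup>2))"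
    by (simp add: power2_norm_eq_inner inner_eq_Re_cinner)
  have "cinner x x = cnj (cinner x x)"
    by (rule cinner_commute)
  then show "Im (cinner x x) = Im (complex_of_real ((norm x)\<^sup>2))"
    by (simp add: complex_eq_iff)
qed

lemma norm_scaleC: "norm (c *\<^sub>C x) = cmod c * norm x"
  for x :: "'a::complex_hilbert_space"
proof -
  have "cinner (c *\<^sub>C x) (c *\<^sub>C x) = c * cnj (c * cinner x x)"
    by (metis cinner_commute cinner_scaleC_left)
  also have "\<dots> = (c * cnj c) * complex_of_real ((norm x)\<^sup>2)"
    by (simp add: cinner_self)
  also have "\<dots> = complex_of_real ((cmod c * norm x)\<^sup>2)"
    by (simp add: complex_norm_square[symmetric] power_mult_distrib)
  finally have "(norm (c *\<^sub>C x))\<^sup>2 = (cmod c * norm x)\<^sup>2"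
    unfolding cinner_self of_real_eq_iff .
  then show ?thesis
    by (simp add: power2_eq_iff_nonneg)
qed


section \<open>Bounded complex linear operators and Schatten classes\<close>

text \<open>The type \<open>'h \<Rightarrow>\<^sub>L 'h\<close> consists of the bounded real-linear maps; the bounded operators
  on the Hilbert space are those that satisfy the following predicate.\<close>

definition clinear_op :: "('h::complex_hilbert_space \<Rightarrow>\<^sub>L 'h) \<Rightarrow> bool" where
  "clinear_op T \<longleftrightarrow> (\<forall>c x. blinfun_apply T (c *\<^sub>C x) = c *\<^sub>C blinfun_apply T x)"

definition selfadjoint_op :: "('h::complex_hilbert_space \<Rightarrow>\<^sub>L 'h) \<Rightarrow> bool" where
  "selfadjoint_op T \<longleftrightarrow> (\<forall>x y. cinner (blinfun_apply T x) y = cinner x (blinfun_apply T y))"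

lift_definition scaleC_op ::
    "complex \<Rightarrow> ('h::complex_hilbert_space \<Rightarrow>\<^sub>L 'h) \<Rightarrow> 'h \<Rightarrow>\<^sub>L 'h"
  is "\<lambda>c T x. c *\<^sub>C T x"
proof -
  fix c :: complex and T :: "'h \<Rightarrow> 'h"
  assume T: "bounded_linear T"
  have "bounded_linear (\<lambda>x::'h. c *\<^sub>C x)"
  proof (rule bounded_linear_intro[where K = "cmod c"])
    show "c *\<^sub>C (r *\<^sub>R x) = r *\<^sub>R (c *\<^sub>C x)" for r and x :: 'h
      by (simp add: scaleC_of_real[symmetric] scaleC_scaleC mult.commute)
  qed (simp_all add: scaleC_add_right norm_scaleC mult.commute)
  from bounded_linear_compose[OF this T] show "bounded_linear (\<lambda>x. c *\<^sub>C T x)" .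
qed

definition rank_le :: "nat \<Rightarrow> ('h::complex_hilbert_space \<Rightarrow>\<^sub>L 'h) \<Rightarrow> bool" where
  "rank_le k F \<longleftrightarrow>
     (\<exists>B. finite B \<and> card B \<le> k \<and> range (blinfun_apply F) \<subseteq> complex_vector.span B)"

text \<open>The singular values, numbered from 0 in nonincreasing order and counted with multiplicity,
  in the form of approximation numbers; for compact \<open>T\<close> these are the eigenvalues of
  \<open>(T\<^sup>*T)\<^sup>1\<^sup>/\<^sup>2\<close>.\<close>

definition singular_value :: "nat \<Rightarrow> ('h::complex_hilbert_space \<Rightarrow>\<^sub>L 'h) \<Rightarrow> real" where
  "singular_value k T = Inf {norm (T - F) | F. clinear_op F \<and> rank_le k F}"

text \<open>Compactness is implied by summability, since then the singular values tend to 0.\<close>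

definition schatten :: "real \<Rightarrow> ('h::complex_hilbert_space \<Rightarrow>\<^sub>L 'h) set" where
  "schatten p = {T. clinear_op T \<and> summable (\<lambda>k. singular_value k T powr p)}"

definition schatten_norm :: "real \<Rightarrow> ('h::complex_hilbert_space \<Rightarrow>\<^sub>L 'h) \<Rightarrow> real" where
  "schatten_norm p T = (\<Sum>k. singular_value k T powr p) powr (1 / p)"

definition schatten_sa :: "real \<Rightarrow> ('h::complex_hilbert_space \<Rightarrow>\<^sub>L 'h) set" where
  "schatten_sa p = {T \<in> schatten p. selfadjoint_op T}"


section \<open>Unbounded self-adjoint operators\<close>

text \<open>A possibly unbounded operator \<open>A\<close> is a partial map whose domain is \<open>dom A\<close>.\<close>

type_synonym 'h operator = "'h \<Rightarrow> 'h option"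

definition linear_operator :: "'h::complex_hilbert_space operator \<Rightarrow> bool" where
  "linear_operator A \<longleftrightarrow>
     complex_vector.subspace (dom A) \<and>
     (\<forall>x\<in>dom A. \<forall>y\<in>dom A. the (A (x + y)) = the (A x) + the (A y)) \<and>
     (\<forall>c. \<forall>x\<in>dom A. the (A (c *\<^sub>C x)) = c *\<^sub>C the (A x))"

definition adjoint_operator :: "'h::complex_hilbert_space operator \<Rightarrow> 'h operator" where
  "adjoint_operator A =
     (\<lambda>y. if \<exists>z. \<forall>x\<in>dom A. cinner (the (A x)) y = cinner x z
          then Some (THE z. \<forall>x\<in>dom A. cinner (the (A x)) y = cinner x z) else None)"

definition self_adjoint :: "'h::complex_hilbert_space operator \<Rightarrow> bool" where
  "self_adjoint A \<longleftrightarrow>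
     linear_operator A \<and> closure (dom A) = UNIV \<and> adjoint_operator A = A"

definition bounded_self_adjoint :: "'h::complex_hilbert_space operator \<Rightarrow> bool" where
  "bounded_self_adjoint A \<longleftrightarrow>
     self_adjoint A \<and> dom A = UNIV \<and> (\<exists>C. \<forall>x. norm (the (A x)) \<le> C * norm x)"

definition add_bounded ::
    "'h::complex_hilbert_space operator \<Rightarrow> ('h \<Rightarrow>\<^sub>L 'h) \<Rightarrow> 'h operator" where
  "add_bounded A X = (\<lambda>x. map_option (\<lambda>y. y + blinfun_apply X x) (A x))"

text \<open>The bounded operator on the whole space that extends \<open>B - C\<close>, whose natural domain is
  \<open>dom B \<inter> dom C\<close>. For \<open>B = f(A+X)\<close> and \<open>C = f(A)\<close> with unbounded \<open>A\<close> and Lipschitz \<open>f\<close>, this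
  domain contains the dense subspace \<open>dom A\<close>.\<close>

definition bounded_difference ::
    "'h::complex_hilbert_space operator \<Rightarrow> 'h operator \<Rightarrow> 'h \<Rightarrow>\<^sub>L 'h" where
  "bounded_difference B C =
     (THE T. clinear_op T \<and>
        (\<forall>x\<in>dom B \<inter> dom C. blinfun_apply T x = the (B x) - the (C x)))"


section \<open>Functional calculus\<close>

definition orthogonal_projection :: "('h::complex_hilbert_space \<Rightarrow>\<^sub>L 'h) \<Rightarrow> bool" where
  "orthogonal_projection P \<longleftrightarrow> clinear_op P \<and> selfadjoint_op P \<and> P o\<^sub>L P = P"

definition projection_valued_measure ::
    "(real set \<Rightarrow> 'h::complex_hilbert_space \<Rightarrow>\<^sub>L 'h) \<Rightarrow> bool" where
  "projection_valued_measure E \<longleftrightarrow>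
     (\<forall>S\<in>sets borel. orthogonal_projection (E S)) \<and>
     E {} = 0 \<and> E UNIV = id_blinfun \<and>
     (\<forall>S\<in>sets borel. \<forall>T\<in>sets borel. E (S \<inter> T) = E S o\<^sub>L E T) \<and>
     (\<forall>S. range S \<subseteq> sets borel \<longrightarrow> disjoint_family S \<longrightarrow>
        (\<forall>x. (\<lambda>i::nat. blinfun_apply (E (S i)) x) sums blinfun_apply (E (\<Union>i. S i)) x))"

definition spectral_scalar_measure ::
    "(real set \<Rightarrow> 'h::complex_hilbert_space \<Rightarrow>\<^sub>L 'h) \<Rightarrow> 'h \<Rightarrow> real measure" where
  "spectral_scalar_measure E x =
     measure_of UNIV (sets borel) (\<lambda>S. ennreal (Re (cinner (blinfun_apply (E S) x) x)))"

text \<open>\<open>B = \<integral> g dE\<close> with its natural domain. A linear operator on a complex Hilbert space with dense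
  domain is determined by its quadratic form, by polarization.\<close>

definition is_spectral_integral ::
    "(real set \<Rightarrow> 'h::complex_hilbert_space \<Rightarrow>\<^sub>L 'h) \<Rightarrow> (real \<Rightarrow> complex) \<Rightarrow> 'h operator \<Rightarrow> bool" where
  "is_spectral_integral E g B \<longleftrightarrow>
     linear_operator B \<and>
     dom B = {x. (\<integral>\<^sup>+s. ennreal ((cmod (g s))\<^sup>2) \<partial>spectral_scalar_measure E x) < \<infinity>} \<and>
     (\<forall>x\<in>dom B. cinner (the (B x)) x = (\<integral>s. g s \<partial>spectral_scalar_measure E x))"

text \<open>\<open>f(A) = \<integral> f dE\<close>, where \<open>E\<close> is the spectral measure of \<open>A\<close>, i.e. \<open>A = \<integral> s dE(s)\<close>. By the spectral
  theorem \<open>E\<close> exists for self-adjoint \<open>A\<close> and is unique on Borel sets, so \<open>f(A)\<close> is well-defined for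
  Borel measurable \<open>f\<close>.\<close>

definition fun_calc ::
    "(real \<Rightarrow> complex) \<Rightarrow> 'h::complex_hilbert_space operator \<Rightarrow> 'h operator" where
  "fun_calc f A =
     (THE B. \<exists>E. projection_valued_measure E \<and>
        is_spectral_integral E complex_of_real A \<and> is_spectral_integral E f B)"

text \<open>\<open>f(A + X) - f(A)\<close>\<close>

definition op_increment ::
    "(real \<Rightarrow> complex) \<Rightarrow> 'h::complex_hilbert_space operator \<Rightarrow> ('h \<Rightarrow>\<^sub>L 'h) \<Rightarrow> 'h \<Rightarrow>\<^sub>L 'h" where
  "op_increment f A X = bounded_difference (fun_calc f (add_bounded A X)) (fun_calc f A)"


section \<open>Gateaux differentiability\<close>

definition has_schatten_derivative ::
    "real \<Rightarrow> (real \<Rightarrow> 'h::complex_hilbert_space \<Rightarrow>\<^sub>L 'h) \<Rightarrow> real \<Rightarrow> ('h \<Rightarrow>\<^sub>L 'h) \<Rightarrow> bool" where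
  "has_schatten_derivative p \<phi> t D \<longleftrightarrow>
     D \<in> schatten p \<and>
     ((\<lambda>h. schatten_norm p ((1 / h) *\<^sub>R (\<phi> (t + h) - \<phi> t) - D)) \<longlongrightarrow> 0) (at 0)"

text \<open>\<open>D\<close> is the \<open>n\<close>-th derivative at \<open>t\<close> of \<open>\<phi>\<close>, a map with values in the Schatten class.\<close>

primrec has_nth_schatten_derivative ::
    "real \<Rightarrow> nat \<Rightarrow> (real \<Rightarrow> 'h::complex_hilbert_space \<Rightarrow>\<^sub>L 'h) \<Rightarrow> real \<Rightarrow> ('h \<Rightarrow>\<^sub>L 'h) \<Rightarrow> bool" where
  "has_nth_schatten_derivative p 0 \<phi> t D \<longleftrightarrow> D = \<phi> t"
| "has_nth_schatten_derivative p (Suc n) \<phi> t D \<longleftrightarrow>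
     (\<exists>\<psi>. (\<forall>\<^sub>F s in nhds t. has_nth_schatten_derivative p n \<phi> s (\<psi> s)) \<and>
          has_schatten_derivative p \<psi> t D)"

text \<open>The first conjunct below expresses that \<open>\<phi>(t) = f(A + tX) - f(A)\<close> maps into the Schatten
  class. It is a known theorem if \<open>f\<close> is Lipschitz, or \<open>f\<close> is locally Lipschitz and \<open>A\<close> is bounded
  (\<open>1 < p < \<infinity>\<close>).\<close>

definition gateaux_differentiable ::
    "real \<Rightarrow> (real \<Rightarrow> complex) \<Rightarrow> nat \<Rightarrow> 'h::complex_hilbert_space operator \<Rightarrow> bool" where
  "gateaux_differentiable p f n A \<longleftrightarrow>
     (\<forall>X\<in>schatten_sa p.
        (\<forall>t. op_increment f A (t *\<^sub>R X) \<in> schatten p) \<and>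
        (\<exists>D. has_nth_schatten_derivative p n (\<lambda>t. op_increment f A (t *\<^sub>R X)) 0 D)) \<and>
     (\<forall>k\<in>{1..n}. \<exists>\<Delta>.
        (\<forall>X\<in>schatten_sa p.
           has_nth_schatten_derivative p k (\<lambda>t. op_increment f A (t *\<^sub>R X)) 0 (\<Delta> X)) \<and>
        (\<forall>c::real. \<forall>X\<in>schatten_sa p. \<Delta> (c *\<^sub>R X) = c ^ k *\<^sub>R \<Delta> X) \<and>
        (\<exists>C. \<forall>X\<in>schatten_sa p. schatten_norm p (\<Delta> X) \<le> C * schatten_norm p X ^ k))"


section \<open>Frechet differentiability\<close>

text \<open>Bounded complex \<open>n\<close>-linear maps from the \<open>n\<close>-fold product of the Schatten class to the Schatten
  class; the elements of the product are lists of length \<open>n\<close>.\<close>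

definition bounded_multilinear ::
    "real \<Rightarrow> nat \<Rightarrow> (('h::complex_hilbert_space \<Rightarrow>\<^sub>L 'h) list \<Rightarrow> 'h \<Rightarrow>\<^sub>L 'h) \<Rightarrow> bool" where
  "bounded_multilinear p n D \<longleftrightarrow>
     (\<forall>Xs\<in>lists (schatten p). length Xs = n \<longrightarrow>
        D Xs \<in> schatten p \<and>
        (\<forall>i<n. \<forall>U\<in>schatten p. \<forall>V\<in>schatten p.
           D (Xs[i := U + V]) = D (Xs[i := U]) + D (Xs[i := V])) \<and>
        (\<forall>i<n. \<forall>c. \<forall>U\<in>schatten p. D (Xs[i := scaleC_op c U]) = scaleC_op c (D (Xs[i := U])))) \<and>
     (\<exists>C. \<forall>Xs\<in>lists (schatten p). length Xs = n \<longrightarrow>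
        schatten_norm p (D Xs) \<le> C * prod_list (map (schatten_norm p) Xs))"

text \<open>\<open>D\<close> is the Frechet derivative of order \<open>n\<close> of \<open>f\<close> at \<open>A\<close>. In the recursive clause \<open>G X\<close> is the
  derivative of order \<open>n\<close> at \<open>A + X\<close> for \<open>X\<close> in a neighborhood of 0 (so \<open>G 0\<close> is the one at \<open>A\<close>); for
  the derivative of order 1 the difference \<open>G X - G 0\<close> is replaced by \<open>f(A + X) - f(A)\<close>, and
  the clause for order 0 imposes no condition. Membership of the remainder in the Schatten class
  is automatic in the setting of the known theorem mentioned above.\<close>

primrec has_frechet_derivative ::
    "real \<Rightarrow> (real \<Rightarrow> complex) \<Rightarrow> nat \<Rightarrow> 'h::complex_hilbert_space operator \<Rightarrow>
     (('h \<Rightarrow>\<^sub>L 'h) list \<Rightarrow> 'h \<Rightarrow>\<^sub>L 'h) \<Rightarrow> bool" where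
  "has_frechet_derivative p f 0 A D \<longleftrightarrow> True"
| "has_frechet_derivative p f (Suc n) A D \<longleftrightarrow>
     bounded_multilinear p (Suc n) D \<and>
     (\<exists>G.
        (\<exists>r>0. \<forall>X\<in>schatten_sa p. schatten_norm p X < r \<longrightarrow>
           has_frechet_derivative p f n (add_bounded A X) (G X)) \<and>
        (\<forall>\<epsilon>>0. \<exists>\<delta>>0. \<forall>X\<in>schatten_sa p. schatten_norm p X < \<delta> \<longrightarrow>
           (\<forall>Xs\<in>lists (schatten p). length Xs = n \<longrightarrow>
              (let R = (if n = 0 then op_increment f A X else G X Xs - G 0 Xs) - D (Xs @ [X])
               in R \<in> schatten p \<and>
                  schatten_norm p R \<le>
                    \<epsilon> * schatten_norm p X * prod_list (map (schatten_norm p) Xs)))))"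

definition frechet_differentiable ::
    "real \<Rightarrow> (real \<Rightarrow> complex) \<Rightarrow> nat \<Rightarrow> 'h::complex_hilbert_space operator \<Rightarrow> bool" where
  "frechet_differentiable p f n A \<longleftrightarrow> (\<exists>D. has_frechet_derivative p f n A D)"


section \<open>Functions on the real line\<close>

definition locally_lipschitz :: "(real \<Rightarrow> complex) \<Rightarrow> bool" where
  "locally_lipschitz f \<longleftrightarrow> (\<forall>x. \<exists>u>0. \<exists>L. L-lipschitz_on (cball x u) f)"

definition nth_deriv :: "nat \<Rightarrow> (real \<Rightarrow> complex) \<Rightarrow> real \<Rightarrow> complex" where
  "nth_deriv k f = ((\<lambda>g x. vector_derivative g (at x)) ^^ k) f"

definition n_times_differentiable :: "nat \<Rightarrow> (real \<Rightarrow> complex) \<Rightarrow> bool" where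
  "n_times_differentiable n f \<longleftrightarrow> (\<forall>k<n. \<forall>x. nth_deriv k f differentiable (at x))"

definition C_n :: "nat \<Rightarrow> (real \<Rightarrow> complex) \<Rightarrow> bool" where
  "C_n n f \<longleftrightarrow> n_times_differentiable n f \<and> continuous_on UNIV (nth_deriv n f)"

end

theory Submission
  imports Defs
begin

text \<open>Take an orthonormal sequence and a self-adjoint operator \<open>A\<close> that is diagonal in it, with eigenvalues
  \<open>l\<^sub>j\<close>. If \<open>P\<close> is the projection onto the \<open>j\<close>-th basis vector, then
  \<open>f(A + tP) - f(A) = (f(l\<^sub>j + t) - f(l\<^sub>j)) P\<close>, so the derivative of order \<open>k\<close> in the direction \<open>P\<close> is
  the \<open>k\<close>-th derivative of \<open>f\<close> at \<open>l\<^sub>j\<close> times \<open>P\<close>. Since \<open>P\<close> has Schatten norm 1, boundedness of the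
  derivative at \<open>A\<close> bounds these numbers uniformly in \<open>j\<close>, and an unbounded sequence of values of the
  \<open>k\<close>-th derivative gives a contradiction. For a Frechet derivative the remainder is also uniform in
  \<open>j\<close>; choosing \<open>l\<^sub>j\<close> convergent, the last derivative is continuous along the sequence.\<close>

text \<open>The functional calculus is a definite description over all spectral measures of the
  operator, so f(A) becomes accessible only once existence and uniqueness of the spectral measure
  are known. Both are proved here for diagonal operators: existence by explicit projections with
  entries 0 and 1, uniqueness because every spectral measure concentrates an eigenvector at its
  eigenvalue. The orthonormal sequence need not be a basis; the projection onto the complement of
  its closed span is kept at index 0, and the vector \<open>e j\<close> belongs to index
  \<open>Suc j\<close>. Limits are taken in the operator norm, which the Schatten norm dominates on
  the Schatten class; outside the class the series for the Schatten norm diverges and bounds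
  nothing, so remainders have to be placed in the class before they are estimated.\<close>

instance complex_hilbert_space \<subseteq> banach ..

section \<open>Complex inner products\<close>

lemma cinner_add_right: "cinner x (y + z) = cinner x y + cinner x z"
  for x :: "'h::complex_hilbert_space"
  by (metis cinner_add_left cinner_commute complex_cnj_add)

lemma cinner_scaleC_right: "cinner x (c *\<^sub>C y) = cnj c * cinner x y"
  for x :: "'h::complex_hilbert_space"
  by (metis cinner_commute cinner_scaleC_left complex_cnj_mult)

lemma cinner_scaleR_left: "cinner (r *\<^sub>R x) y = r *\<^sub>R cinner x y"
  for x :: "'h::complex_hilbert_space"
  by (metis cinner_scaleC_left scaleC_of_real scaleR_conv_of_real)

lemma cinner_scaleR_right: "cinner x (r *\<^sub>R y) = r *\<^sub>R cinner x y"
  for x :: "'h::complex_hilbert_space"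
  by (metis cinner_scaleC_right complex_cnj_complex_of_real scaleC_of_real scaleR_conv_of_real)

text \<open>Multiplying \<open>x\<close> by \<open>c\<close> makes the complex product real and
  nonnegative, which reduces the claim to the real Cauchy-Schwarz inequality. If the product is 0
  then so is \<open>c\<close>, hence only \<open>cmod c \<le> 1\<close>.\<close>

lemma norm_cinner_le: "norm (cinner x y) \<le> norm x * norm y"
  for x :: "'h::complex_hilbert_space"
proof -
  define c where "c = cnj (sgn (cinner x y))"
  have c: "cmod c \<le> 1"
    by (simp add: c_def norm_sgn)
  have "cnj (cinner x y) * cinner x y = complex_of_real ((cmod (cinner x y))\<^sup>2)"
    by (metis complex_norm_square mult.commute)
  then have "c * cinner x y = complex_of_real (cmod (cinner x y))"
    by (cases "cinner x y = 0") (simp_all add: c_def sgn_eq power2_eq_square)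
  then have "norm (cinner x y) = Re (c * cinner x y)"
    by simp
  also have "\<dots> = inner (c *\<^sub>C x) y"
    by (simp add: inner_eq_Re_cinner cinner_scaleC_left)
  also have "\<dots> \<le> norm (c *\<^sub>C x) * norm y"
    by (rule norm_cauchy_schwarz)
  also have "\<dots> \<le> norm x * norm y"
    using c by (intro mult_right_mono) (simp_all add: norm_scaleC mult_left_le_one_le)
  finally show ?thesis .
qed

interpretation cinner: bounded_bilinear "cinner :: 'h \<Rightarrow> 'h::complex_hilbert_space \<Rightarrow> complex"
  by standard
    (auto simp: cinner_add_left cinner_add_right cinner_scaleR_left cinner_scaleR_right
      intro!: exI[of _ 1] norm_cinner_le)

interpretation scaleC: bounded_bilinear "scaleC :: complex \<Rightarrow> 'h \<Rightarrow> 'h::complex_hilbert_space"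
  by standard
    (auto simp: scaleC_add_left scaleC_add_right norm_scaleC scaleR_conv_of_real scaleC_scaleC
      mult.commute simp flip: scaleC_of_real intro!: exI[of _ 1])

lemma cinner_eqI:
  fixes u :: "'h::complex_hilbert_space"
  assumes "\<And>y. cinner u y = cinner v y"
  shows "u = v"
proof -
  have "cinner (u - v) (u - v) = 0"
    using assms by (simp add: cinner.diff_left)
  then show ?thesis
    by (simp add: cinner_self)
qed

text \<open>Complex polarization: the form of the difference vanishes at \<open>x + y\<close> and at
  \<open>x + \<i> *\<^sub>C y\<close>, which forces the sesquilinear form to vanish; density of the
  domain then gives \<open>T x = 0\<close>. Spectral integrals are specified by their quadratic
  form, so they are identified this way.\<close>

lemma linear_operator_eqI:
  fixes A B :: "'h::complex_hilbert_space operator"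
  assumes A: "linear_operator A" and B: "linear_operator B" and dom: "dom A = dom B"
    and dense: "closure (dom A) = UNIV"
    and form: "\<And>x. x \<in> dom A \<Longrightarrow> cinner (the (A x)) x = cinner (the (B x)) x"
  shows "A = B"
proof -
  define T where "T = (\<lambda>x. the (A x) - the (B x))"
  have T_add: "T (x + y) = T x + T y" if "x \<in> dom A" "y \<in> dom A" for x y
    using A B that dom by (auto simp: T_def linear_operator_def)
  have T_scale: "T (c *\<^sub>C x) = c *\<^sub>C T x" if "x \<in> dom A" for c x
    using A B that dom by (auto simp: T_def linear_operator_def scaleC.diff_right)
  have sub: "x + y \<in> dom A" "c *\<^sub>C x \<in> dom A" if "x \<in> dom A" "y \<in> dom A" for x y c
    using A that by (auto simp only: linear_operator_def complex_vector.subspace_def)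
  have T_form: "cinner (T x) x = 0" if "x \<in> dom A" for x
    using form[OF that] by (simp add: T_def cinner.diff_left)
  have *: "cinner (T x) y = 0" if xy: "x \<in> dom A" "y \<in> dom A" for x y
  proof -
    have 1: "cinner (T x) y + cinner (T y) x = 0"
      using T_form[OF sub(1)[OF xy]] T_form xy
      by (simp add: T_add cinner_add_left cinner_add_right add.commute)
    have "cinner (T (x + \<i> *\<^sub>C y)) (x + \<i> *\<^sub>C y) = 0"
      using xy by (intro T_form sub)
    then have "- \<i> * cinner (T x) y + \<i> * cinner (T y) x = 0"
      using T_form xy sub
      by (simp add: T_add T_scale cinner_add_left cinner_add_right cinner_scaleC_left
          cinner_scaleC_right)
    then have "\<i> * (cinner (T y) x - cinner (T x) y) = 0"
      by (simp add: algebra_simps)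
    then show ?thesis
      using 1 by simp
  qed
  have "T x = 0" if x: "x \<in> dom A" for x
  proof -
    have "closed {y. cinner (T x) y = 0}"
      by (intro closed_Collect_eq continuous_intros cinner.continuous_on)
    moreover have "dom A \<subseteq> {y. cinner (T x) y = 0}"
      using * x by auto
    ultimately have "closure (dom A) \<subseteq> {y. cinner (T x) y = 0}"
      by (simp add: closure_minimal)
    then have "cinner (T x) (T x) = 0"
      using dense by auto
    then show ?thesis
      by (simp add: cinner_self)
  qed
  then have T0: "the (A x) = the (B x)" if "x \<in> dom A" for x
    using that by (simp add: T_def)
  show ?thesis
  proof
    fix x
    show "A x = B x"
    proof (cases "x \<in> dom A")
      case True
      then show ?thesis
        using T0 dom by (intro option.expand) auto
    next
      case False
      then show ?thesis
        using dom by (metis domIff)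
    qed
  qed
qed

section \<open>Orthogonal series\<close>

lemma norm_sum_orthogonal:
  fixes y :: "nat \<Rightarrow> 'h::complex_hilbert_space"
  assumes "\<And>i j. i \<noteq> j \<Longrightarrow> cinner (y i) (y j) = 0" "finite I"
  shows "(norm (sum y I))\<^sup>2 = (\<Sum>i\<in>I. (norm (y i))\<^sup>2)"
  using assms
  by (intro norm_sum_Pythagorean) (auto simp: pairwise_def orthogonal_def inner_eq_Re_cinner)

text \<open>By Pythagoras the squared norm of a block of the series is the same block of the series
  of squares, so one Cauchy criterion gives the other.\<close>

lemma summable_orthogonal:
  fixes y :: "nat \<Rightarrow> 'h::complex_hilbert_space"
  assumes orth: "\<And>i j. i \<noteq> j \<Longrightarrow> cinner (y i) (y j) = 0"
    and sq: "summable (\<lambda>i. (norm (y i))\<^sup>2)"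
  shows "summable y"
  unfolding summable_Cauchy
proof (intro allI impI)
  fix \<epsilon> :: real assume "\<epsilon> > 0"
  then have "\<epsilon>\<^sup>2 > 0" by simp
  then obtain N where N: "norm (\<Sum>i=m..<n. (norm (y i))\<^sup>2) < \<epsilon>\<^sup>2" if "m \<ge> N" for m n
    using sq unfolding summable_Cauchy by metis
  have "norm (sum y {m..<n}) < \<epsilon>" if "m \<ge> N" for m n
  proof (rule power_less_imp_less_base)
    show "(norm (sum y {m..<n}))\<^sup>2 < \<epsilon>\<^sup>2"
      using N[OF that, of n] norm_sum_orthogonal[of y "{m..<n}", OF orth] by auto
  qed (use \<open>\<epsilon> > 0\<close> in simp)
  then show "\<exists>N. \<forall>m\<ge>N. \<forall>n. norm (sum y {m..<n}) < \<epsilon>"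
    by blast
qed

text \<open>Gram-Schmidt: finitely many vectors never span the space, and an outside vector minus
  its projection onto their span is nonzero and orthogonal to them.\<close>

lemma ex_orthonormal_sequence:
  assumes inf: "\<not> (\<exists>B :: 'h::complex_hilbert_space set. finite B \<and> complex_vector.span B = UNIV)"
  shows "\<exists>e :: nat \<Rightarrow> 'h. \<forall>i j. cinner (e i) (e j) = (if i = j then 1 else 0)"
proof -
  have "\<exists>e :: nat \<Rightarrow> 'h. \<forall>n. norm (e n) = 1 \<and> (\<forall>i<n. cinner (e n) (e i) = 0)"
  proof (rule dependent_wellorder_choice)
    fix n and e :: "nat \<Rightarrow> 'h"
    assume e: "\<And>m. m < n \<Longrightarrow> norm (e m) = 1 \<and> (\<forall>i<m. cinner (e m) (e i) = 0)"
    have orth: "cinner (e i) (e j) = (if i = j then 1 else 0)" if "i < n" "j < n" for i j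
      using e[OF \<open>i < n\<close>] e[OF \<open>j < n\<close>]
      by (cases i j rule: linorder_cases) (auto simp: cinner_self, metis cinner_commute complex_cnj_zero)
    obtain x where x: "x \<notin> complex_vector.span (e ` {..<n})"
      using inf by blast
    define y where "y = x - (\<Sum>i<n. cinner x (e i) *\<^sub>C e i)"
    have "(\<Sum>i<n. cinner x (e i) *\<^sub>C e i) \<in> complex_vector.span (e ` {..<n})"
      by (intro complex_vector.span_sum complex_vector.span_scale complex_vector.span_base) auto
    then have "y \<noteq> 0"
      using x by (auto simp: y_def)
    have y: "cinner y (e i) = 0" if "i < n" for i
      using that by (simp add: y_def cinner.diff_left cinner.sum_left cinner_scaleC_left orth
          if_distrib[where f = "\<lambda>x. _ * x"] cong: if_cong)
    have "norm ((1 / norm y) *\<^sub>R y) = 1"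
      using \<open>y \<noteq> 0\<close> by simp
    then show "\<exists>v. norm v = 1 \<and> (\<forall>i<n. cinner v (e i) = 0)"
      using y by (intro exI[of _ "(1 / norm y) *\<^sub>R y"]) (simp add: cinner_scaleR_left)
  qed auto
  then obtain e :: "nat \<Rightarrow> 'h" where e: "\<And>n. norm (e n) = 1" "\<And>i n. i < n \<Longrightarrow> cinner (e n) (e i) = 0"
    by metis
  have "cinner (e i) (e j) = (if i = j then 1 else 0)" for i j
    by (cases i j rule: linorder_cases) (auto simp: cinner_self e, metis cinner_commute complex_cnj_zero e(2))
  then show ?thesis
    by blast
qed

section \<open>Diagonal operators\<close>

text \<open>Assumption \<open>orth\<close> packs three facts: for \<open>i = j\<close>
  self-adjointness and idempotence, for \<open>i \<noteq> j\<close> orthogonality of the ranges. No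
  rank is prescribed, so one \<open>P i\<close> can carry a whole infinite-dimensional
  complement.\<close>

locale resolution_of_identity =
  fixes P :: "nat \<Rightarrow> 'h::complex_hilbert_space \<Rightarrow>\<^sub>L 'h"
  assumes clinear: "P i (c *\<^sub>C x) = c *\<^sub>C P i x"
    and orth: "cinner (P i x) (P j y) = (if i = j then cinner (P i x) y else 0)"
    and complete: "(\<lambda>i. P i x) sums x"
begin

lemma P_selfadjoint: "cinner (P i x) y = cinner x (P i y)"
proof -
  have "cinner (P i x) y = cinner (P i x) (P i y)"
    by (simp add: orth)
  also have "\<dots> = cnj (cinner (P i y) (P i x))"
    by (rule cinner_commute)
  also have "\<dots> = cnj (cinner (P i y) x)"
    by (simp add: orth)
  also have "\<dots> = cinner x (P i y)"
    by (rule cinner_commute[symmetric])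
  finally show ?thesis .
qed

lemma P_P: "P i (P j x) = (if i = j then P i x else 0)"
proof (rule cinner_eqI)
  fix y
  have "cinner (P i (P j x)) y = cinner (P j x) (P i y)"
    by (rule P_selfadjoint)
  also have "\<dots> = cinner (if i = j then P i x else 0) y"
    by (subst orth) (simp add: cinner.zero_left)
  finally show "cinner (P i (P j x)) y = cinner (if i = j then P i x else 0) y" .
qed

lemma cinner_sums: "(\<lambda>i. cinner (P i x) y) sums cinner x y"
  by (intro bounded_linear.sums[OF cinner.bounded_linear_left] complete)

lemma norm_sums: "(\<lambda>i. (norm (P i x))\<^sup>2) sums (norm x)\<^sup>2"
proof -
  have "(\<lambda>i. Re (cinner (P i x) x)) sums Re (cinner x x)"
    by (intro sums_Re cinner_sums)
  moreover have "cinner (P i x) x = complex_of_real ((norm (P i x))\<^sup>2)" for i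
    using orth[of i x i x] by (simp add: cinner_self)
  ultimately show ?thesis
    by (simp add: cinner_self)
qed

lemma P_eqI: "(\<And>i. P i x = P i y) \<Longrightarrow> x = y"
  using complete[of x] complete[of y] by (simp add: sums_iff)

definition diag :: "(nat \<Rightarrow> complex) \<Rightarrow> 'h operator" where
  "diag g x = (if summable (\<lambda>i. (cmod (g i) * norm (P i x))\<^sup>2)
     then Some (\<Sum>i. g i *\<^sub>C P i x) else None)"

text \<open>Coordinates decide both domain and value: if some \<open>z\<close> has the coordinates
  \<open>g i *\<^sub>C P i x\<close>, Parseval for \<open>z\<close> yields the summability that puts
  \<open>x\<close> into the domain.\<close>

lemma diag_eq_Some_iff: "diag g x = Some z \<longleftrightarrow> (\<forall>i. P i z = g i *\<^sub>C P i x)"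
proof
  assume "diag g x = Some z"
  then have sq: "summable (\<lambda>i. (cmod (g i) * norm (P i x))\<^sup>2)" and z: "z = (\<Sum>i. g i *\<^sub>C P i x)"
    by (auto simp: diag_def split: if_splits)
  have "summable (\<lambda>i. g i *\<^sub>C P i x)"
    using sq by (intro summable_orthogonal)
      (auto simp: cinner_scaleC_left cinner_scaleC_right orth norm_scaleC)
  then have sums: "(\<lambda>i. g i *\<^sub>C P i x) sums z"
    by (simp add: z summable_sums)
  show "\<forall>i. P i z = g i *\<^sub>C P i x"
  proof
    fix j
    have "(\<lambda>i. P j (g i *\<^sub>C P i x)) sums P j z"
      by (intro bounded_linear.sums[OF blinfun.bounded_linear_right] sums)
    moreover have "(\<lambda>i. P j (g i *\<^sub>C P i x)) = (\<lambda>i. if i = j then g j *\<^sub>C P j x else 0)"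
      by (auto simp: clinear P_P)
    ultimately show "P j z = g j *\<^sub>C P j x"
      using sums_single[of j "\<lambda>_. g j *\<^sub>C P j x"] by (simp add: sums_iff)
  qed
next
  assume z: "\<forall>i. P i z = g i *\<^sub>C P i x"
  have "summable (\<lambda>i. (cmod (g i) * norm (P i x))\<^sup>2)"
    using norm_sums[of z] z by (simp add: norm_scaleC sums_iff)
  moreover have "(\<lambda>i. g i *\<^sub>C P i x) sums z"
    using complete[of z] z by simp
  ultimately show "diag g x = Some z"
    by (simp add: diag_def sums_iff)
qed

lemma dom_diag: "dom (diag g) = {x. summable (\<lambda>i. (cmod (g i) * norm (P i x))\<^sup>2)}"
  by (auto simp: diag_def split: if_splits)

lemma P_diag: "x \<in> dom (diag g) \<Longrightarrow> P i (the (diag g x)) = g i *\<^sub>C P i x"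
  by (metis diag_eq_Some_iff domD option.sel)

lemma diag_P: "diag g (P i x) = Some (g i *\<^sub>C P i x)"
  by (auto simp: diag_eq_Some_iff clinear P_P)

lemma P_in_dom_diag: "P i x \<in> dom (diag g)"
  by (simp add: domI diag_P)

lemma linear_operator_diag: "linear_operator (diag g)"
proof -
  have 0: "diag g 0 = Some 0"
    by (simp add: diag_eq_Some_iff)
  have add: "diag g (x + y) = Some (u + v)" if "diag g x = Some u" "diag g y = Some v" for x y u v
    using that by (simp add: diag_eq_Some_iff blinfun.add_right scaleC_add_right)
  have scale: "diag g (c *\<^sub>C x) = Some (c *\<^sub>C u)" if "diag g x = Some u" for c x u
    using that by (simp add: diag_eq_Some_iff clinear scaleC_scaleC mult.commute)
  show ?thesis
    unfolding linear_operator_def complex_vector.subspace_def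
  proof (intro conjI ballI allI)
    show "0 \<in> dom (diag g)"
      using 0 by blast
    fix c x assume "x \<in> dom (diag g)"
    then obtain u where u: "diag g x = Some u" by blast
    show "c *\<^sub>C x \<in> dom (diag g)" "the (diag g (c *\<^sub>C x)) = c *\<^sub>C the (diag g x)"
      using scale[OF u, of c] u by auto
    fix y assume "y \<in> dom (diag g)"
    then obtain v where v: "diag g y = Some v" by blast
    show "x + y \<in> dom (diag g)" "the (diag g (x + y)) = the (diag g x) + the (diag g y)"
      using add[OF u v] u v by auto
  qed
qed

lemma closure_dom_diag: "closure (dom (diag g)) = UNIV"
proof -
  have "x \<in> closure (dom (diag g))" for x
    unfolding closure_sequential
  proof (intro exI conjI allI)
    show "(\<lambda>n. \<Sum>i<n. P i x) \<longlonglongrightarrow> x"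
      using complete[of x] by (simp add: sums_def)
    show "(\<Sum>i<n. P i x) \<in> dom (diag g)" for n
      using linear_operator_diag[of g] P_in_dom_diag
      by (intro complex_vector.subspace_sum) (auto simp: linear_operator_def)
  qed
  then show ?thesis by auto
qed

text \<open>The vectors \<open>P i w\<close> all lie in the domain, and testing the adjoint relation
  on them determines the coordinates of \<open>z\<close>. As the entries are real, these are the
  coordinates of \<open>A y\<close>, and \<open>diag_eq_Some_iff\<close> turns this into membership
  of \<open>y\<close> in the domain.\<close>

lemma self_adjoint_diag: "self_adjoint (diag (\<lambda>i. complex_of_real (l i)))"
proof -
  define A where "A = diag (\<lambda>i. complex_of_real (l i))"
  have *: "(\<forall>x\<in>dom A. cinner (the (A x)) y = cinner x z) \<longleftrightarrow> A y = Some z" for y z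
  proof
    assume yz: "\<forall>x\<in>dom A. cinner (the (A x)) y = cinner x z"
    show "A y = Some z"
      unfolding A_def diag_eq_Some_iff
    proof
      fix i
      show "P i z = complex_of_real (l i) *\<^sub>C P i y"
      proof (rule cinner_eqI)
        fix w
        have "cinner (the (A (P i w))) y = cinner (P i w) z"
          using yz P_in_dom_diag unfolding A_def by blast
        then have "complex_of_real (l i) * cinner w (P i y) = cinner w (P i z)"
          by (simp add: A_def diag_P cinner_scaleC_left P_selfadjoint)
        then have "cinner w (P i z) = cinner w (complex_of_real (l i) *\<^sub>C P i y)"
          by (simp add: cinner_scaleC_right)
        then show "cinner (P i z) w = cinner (complex_of_real (l i) *\<^sub>C P i y) w"
          by (simp only: cinner_commute[of _ w])
      qed
    qed
  next
    assume "A y = Some z"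
    then have z: "P i z = complex_of_real (l i) *\<^sub>C P i y" for i
      by (simp add: A_def diag_eq_Some_iff)
    show "\<forall>x\<in>dom A. cinner (the (A x)) y = cinner x z"
    proof
      fix x assume x: "x \<in> dom A"
      have "cinner (P i (the (A x))) y = cinner (P i x) z" for i
      proof -
        have "cinner (P i (the (A x))) y = complex_of_real (l i) * cinner (P i x) y"
          using x unfolding A_def by (simp only: P_diag cinner_scaleC_left)
        also have "\<dots> = cinner (P i x) z"
          by (simp add: P_selfadjoint z cinner_scaleC_right)
        finally show ?thesis .
      qed
      then show "cinner (the (A x)) y = cinner x z"
        using cinner_sums[of "the (A x)" y] cinner_sums[of x z] sums_unique2 by simp
    qed
  qed
  have "adjoint_operator A y = A y" for y
    unfolding adjoint_operator_def * by (cases "A y") simp_all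
  then have "adjoint_operator A = A"
    by (rule ext)
  then show ?thesis
    unfolding self_adjoint_def A_def using linear_operator_diag closure_dom_diag by blast
qed

lemma norm_le_if_P_le:
  assumes "\<And>i. norm (P i z) \<le> K * norm (P i x)" "0 \<le> K"
  shows "norm z \<le> K * norm x"
proof -
  have "(norm (P i z))\<^sup>2 \<le> K\<^sup>2 * (norm (P i x))\<^sup>2" for i
    using power_mono[OF assms(1) norm_ge_zero, of i 2] by (simp add: power_mult_distrib)
  then have "(norm z)\<^sup>2 \<le> K\<^sup>2 * (norm x)\<^sup>2"
    by (rule sums_le[OF _ norm_sums[of z] sums_mult[OF norm_sums[of x]]])
  then have "(norm z)\<^sup>2 \<le> (K * norm x)\<^sup>2"
    by (simp only: power_mult_distrib)
  then show ?thesis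
    using \<open>0 \<le> K\<close>
    by (intro power2_le_imp_le[of "norm z" "K * norm x"] mult_nonneg_nonneg norm_ge_zero)
qed

lemma dom_diag_bounded:
  assumes "\<And>i. cmod (g i) \<le> K"
  shows "dom (diag g) = UNIV"
proof -
  have "summable (\<lambda>i. (cmod (g i) * norm (P i x))\<^sup>2)" for x
  proof (rule summable_comparison_test)
    show "summable (\<lambda>i. K\<^sup>2 * (norm (P i x))\<^sup>2)"
      by (intro summable_mult sums_summable[OF norm_sums])
    show "\<exists>N. \<forall>n\<ge>N. norm ((cmod (g n) * norm (P n x))\<^sup>2) \<le> K\<^sup>2 * (norm (P n x))\<^sup>2"
      using assms by (auto simp: power_mult_distrib intro!: mult_right_mono power_mono)
  qed
  then show ?thesis
    by (simp add: dom_diag)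
qed

lemma norm_diag_le:
  assumes "\<And>i. cmod (g i) \<le> K"
  shows "norm (the (diag g x)) \<le> K * norm x"
proof (rule norm_le_if_P_le)
  show "norm (P i (the (diag g x))) \<le> K * norm (P i x)" for i
    using assms by (simp add: P_diag dom_diag_bounded[OF assms] norm_scaleC mult_right_mono)
  show "0 \<le> K"
    by (rule order_trans[OF norm_ge_zero assms[of 0]])
qed

lemma bounded_self_adjoint_diag:
  assumes "\<And>i. \<bar>l i\<bar> \<le> K"
  shows "bounded_self_adjoint (diag (\<lambda>i. complex_of_real (l i)))"
  unfolding bounded_self_adjoint_def
proof (intro conjI exI allI)
  have l: "cmod (complex_of_real (l i)) \<le> K" for i
    using assms by simp
  show "self_adjoint (diag (\<lambda>i. complex_of_real (l i)))"
    by (rule self_adjoint_diag)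
  show "dom (diag (\<lambda>i. complex_of_real (l i))) = UNIV"
    by (rule dom_diag_bounded[OF l])
  show "norm (the (diag (\<lambda>i. complex_of_real (l i)) x)) \<le> K * norm x" for x
    by (rule norm_diag_le[OF l])
qed

section \<open>Spectral projections of diagonal operators\<close>

definition spectral_projection :: "(nat \<Rightarrow> real) \<Rightarrow> real set \<Rightarrow> 'h \<Rightarrow>\<^sub>L 'h" where
  "spectral_projection l S = Blinfun (\<lambda>x. the (diag (\<lambda>i. if l i \<in> S then 1 else 0) x))"

text \<open>Entries 0 and 1 give an everywhere defined bounded operator; this is what makes
  \<open>Blinfun\<close> in the definition denote the intended map.\<close>

lemma P_spectral_projection:
  "P i (spectral_projection l S x) = (if l i \<in> S then P i x else 0)"
proof -
  define g :: "nat \<Rightarrow> complex" where "g = (\<lambda>i. if l i \<in> S then 1 else 0)"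
  have g: "cmod (g i) \<le> 1" for i
    by (simp add: g_def)
  note dom = dom_diag_bounded[of g 1, OF g]
  note diag = P_diag[of _ g, unfolded dom, simplified]
  have "bounded_linear (\<lambda>x. the (diag g x))"
  proof (rule bounded_linear_intro[where K = 1])
    show "the (diag g (x + y)) = the (diag g x) + the (diag g y)" for x y
      by (rule P_eqI) (simp add: diag blinfun.add_right scaleC_add_right)
    show "the (diag g (r *\<^sub>R x)) = r *\<^sub>R the (diag g x)" for r x
      by (rule P_eqI) (simp add: diag blinfun.scaleR_right scaleC.scaleR_right)
    show "norm (the (diag g x)) \<le> norm x * 1" for x
      using norm_diag_le[of g 1, OF g] by simp
  qed
  then have "spectral_projection l S x = the (diag g x)"
    by (simp add: spectral_projection_def g_def bounded_linear_Blinfun_apply)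
  then show ?thesis
    using diag[of i x] by (simp add: g_def)
qed

lemma spectral_projection_P:
  "spectral_projection l S (P i x) = (if l i \<in> S then P i x else 0)"
  by (rule P_eqI) (simp add: P_spectral_projection P_P)

lemma cinner_spectral_projection:
  "cinner (spectral_projection l S x) (spectral_projection l T y) =
   cinner (spectral_projection l (S \<inter> T) x) y"
proof -
  have "cinner (P i (spectral_projection l S x)) (spectral_projection l T y) =
      cinner (P i (spectral_projection l (S \<inter> T) x)) y" for i
    by (simp add: P_spectral_projection P_selfadjoint cinner.zero_left cinner.zero_right)
  then show ?thesis
    using cinner_sums[of "spectral_projection l S x" "spectral_projection l T y"]
      cinner_sums[of "spectral_projection l (S \<inter> T) x" y] by (simp add: sums_iff)
qed

lemma spectral_projection_UNIV: "spectral_projection l UNIV = id_blinfun"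
  by (rule blinfun_eqI, rule P_eqI) (simp add: P_spectral_projection)

lemma orthogonal_projection_spectral_projection: "orthogonal_projection (spectral_projection l S)"
proof -
  have "cinner (spectral_projection l S x) y = cinner x (spectral_projection l S y)" for x y
    using cinner_spectral_projection[of l S x UNIV y] cinner_spectral_projection[of l UNIV x S y]
    by (simp add: spectral_projection_UNIV)
  moreover have "spectral_projection l S o\<^sub>L spectral_projection l S = spectral_projection l S"
    by (rule blinfun_eqI, rule P_eqI) (simp add: P_spectral_projection)
  moreover have "spectral_projection l S (c *\<^sub>C x) = c *\<^sub>C spectral_projection l S x" for c x
    by (rule P_eqI) (simp add: P_spectral_projection clinear)
  ultimately show ?thesis
    unfolding orthogonal_projection_def clinear_op_def selfadjoint_op_def by blast
qed

text \<open>The pieces are mutually orthogonal and each partial sum is the projection for a finite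
  union, hence of norm at most \<open>norm x\<close>; this gives convergence. The limit is
  identified by its coordinates, each of which meets at most one set of the family.\<close>

lemma spectral_projection_sums:
  assumes disj: "disjoint_family S"
  shows "(\<lambda>i::nat. spectral_projection l (S i) x) sums spectral_projection l (\<Union>i. S i) x"
proof -
  have unique: "i = k" if "l j \<in> S i" "l j \<in> S k" for i j k
    using disjoint_family_onD[OF disj, of i k] that by blast
  have P_sums: "(\<lambda>i. P j (spectral_projection l (S i) x)) sums P j (spectral_projection l (\<Union>i. S i) x)"
    for j
  proof (cases "\<exists>k. l j \<in> S k")
    case True
    then obtain k where k: "l j \<in> S k" by blast
    have "P j (spectral_projection l (S i) x) = (if i = k then P j x else 0)" for i
      using k unique by (auto simp: P_spectral_projection)
    moreover have "P j (spectral_projection l (\<Union>i. S i) x) = P j x"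
      using True by (simp add: P_spectral_projection)
    ultimately show ?thesis
      using sums_single[of k "\<lambda>_. P j x"] by simp
  next
    case False
    then show ?thesis
      by (simp add: P_spectral_projection)
  qed
  have orth': "cinner (spectral_projection l (S i) x) (spectral_projection l (S j) x) = 0"
    if "i \<noteq> j" for i j
  proof -
    have "S i \<inter> S j = {}"
      using disjoint_family_onD[OF disj, of i j] that by blast
    moreover have "spectral_projection l {} x = 0"
      by (rule P_eqI) (simp add: P_spectral_projection)
    ultimately show ?thesis
      by (simp add: cinner_spectral_projection cinner.zero_left)
  qed
  have "summable (\<lambda>i. (norm (spectral_projection l (S i) x))\<^sup>2)"
  proof (rule bounded_imp_summable)
    fix n
    have "(\<Sum>i\<le>n. (norm (spectral_projection l (S i) x))\<^sup>2) =
        (norm (\<Sum>i\<le>n. spectral_projection l (S i) x))\<^sup>2"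
      by (rule norm_sum_orthogonal[symmetric]) (auto simp: orth')
    also have "(\<Sum>i\<le>n. spectral_projection l (S i) x) = spectral_projection l (\<Union>i\<le>n. S i) x"
    proof (rule P_eqI)
      fix j
      show "P j (\<Sum>i\<le>n. spectral_projection l (S i) x) = P j (spectral_projection l (\<Union>i\<le>n. S i) x)"
      proof (cases "\<exists>k\<le>n. l j \<in> S k")
        case True
        then obtain k where k: "k \<le> n" "l j \<in> S k" by blast
        have "P j (spectral_projection l (S i) x) = (if i = k then P j x else 0)" for i
          using k unique by (auto simp: P_spectral_projection)
        moreover have "P j (spectral_projection l (\<Union>i\<le>n. S i) x) = P j x"
          using True by (auto simp: P_spectral_projection)
        ultimately show ?thesis
          using k by (simp add: blinfun.sum_right)
      next
        case False
        then show ?thesis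
          by (simp add: P_spectral_projection blinfun.sum_right)
      qed
    qed
    also have "(norm (spectral_projection l (\<Union>i\<le>n. S i) x))\<^sup>2 \<le> (norm x)\<^sup>2"
      using norm_le_if_P_le[of "spectral_projection l (\<Union>i\<le>n. S i) x" 1 x]
      by (intro power_mono) (auto simp: P_spectral_projection)
    finally show "(\<Sum>i\<le>n. (norm (spectral_projection l (S i) x))\<^sup>2) \<le> (norm x)\<^sup>2"
      .
  qed simp
  then have summable: "summable (\<lambda>i. spectral_projection l (S i) x)"
    using orth' by (intro summable_orthogonal)
  have "(\<Sum>i. spectral_projection l (S i) x) = spectral_projection l (\<Union>i. S i) x"
  proof (rule P_eqI)
    fix j
    have "(\<lambda>i. P j (spectral_projection l (S i) x)) sums P j (\<Sum>i. spectral_projection l (S i) x)"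
      by (intro bounded_linear.sums[OF blinfun.bounded_linear_right] summable_sums summable)
    then show "P j (\<Sum>i. spectral_projection l (S i) x) = P j (spectral_projection l (\<Union>i. S i) x)"
      using P_sums sums_unique2 by blast
  qed
  then show ?thesis
    using summable by (simp add: sums_iff)
qed

lemma projection_valued_measure_spectral_projection:
  "projection_valued_measure (spectral_projection l)"
  unfolding projection_valued_measure_def
proof (intro conjI ballI allI impI)
  show "spectral_projection l {} = 0"
    by (rule blinfun_eqI, rule P_eqI) (simp add: P_spectral_projection)
  show "spectral_projection l (S \<inter> T) = spectral_projection l S o\<^sub>L spectral_projection l T" for S T
    by (rule blinfun_eqI, rule P_eqI) (simp add: P_spectral_projection)
qed (simp_all add: orthogonal_projection_spectral_projection spectral_projection_UNIV
    spectral_projection_sums)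

end

section \<open>Spectral measures and eigenvectors\<close>

context
  fixes E :: "real set \<Rightarrow> 'h::complex_hilbert_space \<Rightarrow>\<^sub>L 'h"
  assumes E: "projection_valued_measure E"
begin

lemma pvm_selfadjoint: "S \<in> sets borel \<Longrightarrow> cinner (E S x) y = cinner x (E S y)"
  using E by (simp add: projection_valued_measure_def orthogonal_projection_def selfadjoint_op_def)

lemma pvm_clinear: "S \<in> sets borel \<Longrightarrow> E S (c *\<^sub>C x) = c *\<^sub>C E S x"
  using E by (simp add: projection_valued_measure_def orthogonal_projection_def clinear_op_def)

lemma pvm_Int: "S \<in> sets borel \<Longrightarrow> T \<in> sets borel \<Longrightarrow> E (S \<inter> T) x = E S (E T x)"
  using E by (simp add: projection_valued_measure_def)

lemma pvm_empty: "E {} x = 0" and pvm_UNIV: "E UNIV x = x"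
  using E by (simp_all add: projection_valued_measure_def)

lemma pvm_cinner:
  assumes "S \<in> sets borel" "T \<in> sets borel"
  shows "cinner (E S x) (E T y) = cinner (E (S \<inter> T) x) y"
  using assms by (metis Int_commute pvm_Int pvm_selfadjoint)

lemma pvm_norm_cinner: "S \<in> sets borel \<Longrightarrow> Re (cinner (E S x) x) = (norm (E S x))\<^sup>2"
  using pvm_cinner[of S S x x] by (metis Int_absorb Re_complex_of_real cinner_self)

section \<open>Scalar measures of an arbitrary projection-valued measure\<close>

lemma sets_spectral_scalar_measure [measurable_cong]:
  "sets (spectral_scalar_measure E x) = sets borel"
  unfolding spectral_scalar_measure_def
  using sets.sigma_sets_eq[of "borel :: real measure"] by (simp add: sets_measure_of)

lemma space_spectral_scalar_measure [simp]: "space (spectral_scalar_measure E x) = UNIV"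
  by (simp add: spectral_scalar_measure_def space_measure_of_conv)

text \<open>\<open>measure_of\<close> has the intended values only if the set function is countably
  additive; pairing the strongly convergent series of projections with \<open>x\<close> supplies
  this.\<close>

lemma emeasure_spectral_scalar_measure:
  assumes S: "S \<in> sets borel"
  shows "emeasure (spectral_scalar_measure E x) S = ennreal ((norm (E S x))\<^sup>2)"
proof -
  have "emeasure (spectral_scalar_measure E x) S = ennreal (Re (cinner (E S x) x))"
  proof (rule emeasure_measure_of[OF spectral_scalar_measure_def])
    show "positive (sets (spectral_scalar_measure E x)) (\<lambda>S. ennreal (Re (cinner (E S x) x)))"
      by (simp add: positive_def pvm_empty cinner.zero_left)
    show "countably_additive (sets (spectral_scalar_measure E x)) (\<lambda>S. ennreal (Re (cinner (E S x) x)))"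
      unfolding countably_additive_def sets_spectral_scalar_measure
    proof (intro allI impI)
      fix A :: "nat \<Rightarrow> real set"
      assume A: "range A \<subseteq> sets borel" "disjoint_family A" "\<Union> (range A) \<in> sets borel"
      have "(\<lambda>i. E (A i) x) sums E (\<Union>i. A i) x"
        using E A by (simp add: projection_valued_measure_def)
      then have "(\<lambda>i. Re (cinner (E (A i) x) x)) sums Re (cinner (E (\<Union>i. A i) x) x)"
        by (intro sums_Re bounded_linear.sums[OF cinner.bounded_linear_left])
      moreover have "0 \<le> Re (cinner (E (A i) x) x)" for i
        using A(1) by (subst pvm_norm_cinner) auto
      ultimately show "(\<Sum>i. ennreal (Re (cinner (E (A i) x) x))) =
          ennreal (Re (cinner (E (\<Union> (range A)) x) x))"
        by (intro suminf_ennreal_eq) auto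
    qed
  qed (use S sets_spectral_scalar_measure in auto)
  then show ?thesis
    using S by (simp add: pvm_norm_cinner)
qed

lemma finite_spectral_scalar_measure: "finite_measure (spectral_scalar_measure E x)"
  by (rule finite_measureI) (simp add: emeasure_spectral_scalar_measure)

lemma measure_spectral_scalar_measure:
  "S \<in> sets borel \<Longrightarrow> measure (spectral_scalar_measure E x) S = (norm (E S x))\<^sup>2"
  by (simp add: measure_def emeasure_spectral_scalar_measure)

text \<open>Multiplying the component outside \<open>ran E T\<close> by a unimodular number does not change the
  scalar measure; hence, by polarization, \<open>ran E T\<close> reduces the operator.\<close>

lemma spectral_projection_reduces:
  assumes A: "is_spectral_integral E g A" and T: "T \<in> sets borel" and x: "x \<in> dom A"
  shows "E T x \<in> dom A" "x - E T x \<in> dom A" "cinner (the (A (x - E T x))) (E T x) = 0"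
proof -
  define u where "u = E T x"
  define v where "v = x - u"
  have xuv: "x = u + v"
    by (simp add: v_def)
  have measure_eq: "spectral_scalar_measure E (u + c *\<^sub>C v) = spectral_scalar_measure E x"
    if c: "cmod c = 1" for c
  proof (rule measure_eqI)
    fix S assume "S \<in> sets (spectral_scalar_measure E (u + c *\<^sub>C v))"
    then have S: "S \<in> sets borel"
      by (simp add: sets_spectral_scalar_measure)
    have "E T v = 0"
      using pvm_Int[OF T T, of x] by (simp add: v_def u_def blinfun.diff_right)
    moreover have "E S u = E T (E S x)"
      using pvm_Int[OF S T, of x] pvm_Int[OF T S, of x] by (simp add: u_def Int_commute)
    moreover have "E T (E S v) = E S (E T v)"
      using pvm_Int[OF S T, of v] pvm_Int[OF T S, of v] by (simp add: Int_commute)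
    ultimately have 0: "cinner (E S u) (E S v) = 0"
      using pvm_selfadjoint[OF T, of "E S x" "E S v"] by (simp add: cinner.zero_right)
    have *: "(norm (E S (u + d *\<^sub>C v)))\<^sup>2 = (norm (E S u))\<^sup>2 + (norm (E S v))\<^sup>2"
      if "cmod d = 1" for d
    proof -
      have "orthogonal (E S u) (d *\<^sub>C E S v)"
        using 0 by (simp add: orthogonal_def inner_eq_Re_cinner cinner_scaleC_right)
      then show ?thesis
        using norm_add_Pythagorean[of "E S u" "d *\<^sub>C E S v"] that
        by (simp add: blinfun.add_right pvm_clinear[OF S] norm_scaleC)
    qed
    show "emeasure (spectral_scalar_measure E (u + c *\<^sub>C v)) S = emeasure (spectral_scalar_measure E x) S"
      using *[OF c] *[of 1] xuv by (simp add: emeasure_spectral_scalar_measure S)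
  qed (simp add: sets_spectral_scalar_measure)
  have lin: "linear_operator A"
    and dom: "dom A = {x. (\<integral>\<^sup>+s. ennreal ((cmod (g s))\<^sup>2) \<partial>spectral_scalar_measure E x) < \<infinity>}"
    and form: "\<And>x. x \<in> dom A \<Longrightarrow> cinner (the (A x)) x = (\<integral>s. g s \<partial>spectral_scalar_measure E x)"
    using A by (auto simp: is_spectral_integral_def)
  have sub: "complex_vector.subspace (dom A)"
    and add: "\<And>x y. x \<in> dom A \<Longrightarrow> y \<in> dom A \<Longrightarrow> the (A (x + y)) = the (A x) + the (A y)"
    and scale: "\<And>c x. x \<in> dom A \<Longrightarrow> the (A (c *\<^sub>C x)) = c *\<^sub>C the (A x)"
    using lin by (auto simp: linear_operator_def)
  have uv: "u + c *\<^sub>C v \<in> dom A" if "cmod c = 1" for c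
    using x measure_eq[OF that] unfolding dom by simp
  \<comment> \<open>\<open>u\<close> is the midpoint of \<open>u + v\<close> and
    \<open>u - v\<close>, which have equal scalar measures and therefore both lie in the
    domain.\<close>
  have "(1/2) *\<^sub>C (x + (u + (- 1) *\<^sub>C v)) \<in> dom A"
    using uv[of "- 1"] x sub by (simp add: complex_vector.subspace_add complex_vector.subspace_scale)
  also have "x + (u + (- 1) *\<^sub>C v) = 2 *\<^sub>C u"
    using scaleC_add_left[of 1 1 u] by (simp add: xuv)
  finally show u: "E T x \<in> dom A"
    by (simp add: u_def)
  show v: "x - E T x \<in> dom A"
    by (intro complex_vector.subspace_diff sub x u)
  define a where "a = cinner (the (A u)) v"
  define b where "b = cinner (the (A v)) u"
  define q where "q = cinner (the (A u)) u + cinner (the (A v)) v"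
  have "cinner (the (A (u + c *\<^sub>C v))) (u + c *\<^sub>C v) = q + cnj c * a + c * b" if "cmod c = 1" for c
  proof -
    have "u \<in> dom A" "v \<in> dom A" "c *\<^sub>C v \<in> dom A"
      using u v sub by (simp_all add: u_def v_def complex_vector.subspace_scale)
    moreover have "c * cnj c = 1"
      using that by (simp add: complex_norm_square[symmetric])
    then have "c * (cnj c * cinner (the (A v)) v) = cinner (the (A v)) v"
      by (simp flip: mult.assoc)
    ultimately show ?thesis
      by (simp add: add scale cinner_add_left cinner_add_right cinner_scaleC_left
          cinner_scaleC_right a_def b_def q_def algebra_simps)
  qed
  \<comment> \<open>The left side is a trigonometric polynomial that is constant on the unit circle;
    its values at 1, -1 and \<i> suffice to make \<open>b\<close> vanish.\<close>
  then have const: "q + cnj c * a + c * b = (\<integral>s. g s \<partial>spectral_scalar_measure E x)" if "cmod c = 1" for c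
    using form[OF uv[OF that]] measure_eq[OF that] that by simp
  have "a + b = 0"
    using const[of 1] const[of "- 1"] by (simp add: complex_eq_iff)
  moreover have "q + cnj \<i> * a + \<i> * b = q + cnj 1 * a + 1 * b"
    using const[of "\<i>"] const[of 1] by simp
  then have "\<i> * (b - a) = a + b"
    by (simp add: algebra_simps)
  ultimately have "b = 0"
    by simp
  then show "cinner (the (A (x - E T x))) (E T x) = 0"
    by (simp add: b_def u_def v_def)
qed

text \<open>For a Borel set \<open>T\<close> on one side of \<open>a\<close> let
  \<open>u = E T x\<close>. As the range of \<open>E T\<close> reduces \<open>A\<close>, the
  integral of \<open>s - a\<close> against the scalar measure of \<open>u\<close> is 0, while the
  integrand has a strict sign on \<open>T\<close>; so \<open>u = 0\<close>. One side at a time is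
  treated because the definition gives the form of \<open>A\<close>, hence integrals of
  \<open>s - a\<close>, and not directly the norm of \<open>A x - a x\<close> as an integral of its
  square.\<close>

lemma spectral_projection_eigenvector:
  assumes A: "is_spectral_integral E complex_of_real A"
    and x: "A x = Some (complex_of_real a *\<^sub>C x)" and S: "S \<in> sets borel"
  shows "E S x = (if a \<in> S then x else 0)"
proof -
  \<comment> \<open>\<open>\<sigma>\<close> is 1 for sets to the right of \<open>a\<close> and -1
    for sets to the left.\<close>
  have half: "E T x = 0" if T: "T \<in> sets borel" and pos: "\<And>s. s \<in> T \<Longrightarrow> \<sigma> * (s - a) > 0"
    for T and \<sigma> :: real
  proof -
    define u where "u = E T x"
    define M where "M = spectral_scalar_measure E u"
    interpret M: finite_measure M
      unfolding M_def by (rule finite_spectral_scalar_measure)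
    have sets_M [measurable_cong]: "sets M = sets borel" and space_M: "space M = UNIV"
      by (simp_all add: M_def sets_spectral_scalar_measure)
    have xA: "x \<in> dom A"
      using x by blast
    note red = spectral_projection_reduces[OF A T xA, folded u_def]
    have lin: "the (A (u + (x - u))) = the (A u) + the (A (x - u))"
      using A red by (auto simp only: is_spectral_integral_def linear_operator_def)
    have "cinner x u = of_real ((norm u)\<^sup>2)"
      using pvm_selfadjoint[OF T, of x "E T x"] pvm_Int[OF T T, of x] by (simp add: u_def cinner_self)
    then have "cinner (the (A x)) u = of_real (a * (norm u)\<^sup>2)"
      by (simp add: x cinner_scaleC_left)
    moreover have "cinner (the (A x)) u = cinner (the (A u)) u"
      using lin red(3) by (simp add: cinner_add_left)
    moreover have "cinner (the (A u)) u = (\<integral>s. complex_of_real s \<partial>M)"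
      using A red(1) by (auto simp: is_spectral_integral_def M_def)
    ultimately have int: "(\<integral>s. s \<partial>M) = a * (norm u)\<^sup>2"
      by (simp only: integral_complex_of_real of_real_eq_iff)
    have "(\<integral>\<^sup>+s. ennreal (s\<^sup>2) \<partial>M) < \<infinity>"
      using A red(1) unfolding is_spectral_integral_def M_def by auto
    then have sq: "integrable M (\<lambda>s. s\<^sup>2)"
      by (intro integrableI_nonneg) auto
    \<comment> \<open>The domain condition is square integrability; the measure being finite,
      \<open>\<bar>s\<bar> \<le> 1 + s\<^sup>2\<close> gives integrability of the first
      power.\<close>
    have integrable: "integrable M (\<lambda>s. s)"
    proof (rule Bochner_Integration.integrable_bound)
      show "integrable M (\<lambda>s. 1 + s\<^sup>2)"
        using sq by simp
      have "\<bar>s\<bar> \<le> 1 + s\<^sup>2" for s :: real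
      proof (cases "\<bar>s\<bar> \<le> 1")
        case False
        then show ?thesis
          using mult_mono[of 1 "\<bar>s\<bar>" "\<bar>s\<bar>" "\<bar>s\<bar>"] by (simp add: power2_eq_square)
      qed (simp add: add_increasing2)
      then show "AE s in M. norm s \<le> norm (1 + s\<^sup>2)"
        by simp
    qed simp
    have mass: "measure M UNIV = (norm u)\<^sup>2"
      by (simp add: M_def measure_spectral_scalar_measure pvm_UNIV)
    have "E (- T) u = 0"
      using T pvm_Int[of "- T" T x] by (simp add: u_def pvm_empty)
    then have "emeasure M (- T) = 0"
      using T by (simp add: M_def emeasure_spectral_scalar_measure)
    then have AE_T: "AE s in M. s \<in> T"
      using T by (intro AE_I[of _ _ "- T"]) (auto simp: sets_M)
    have "(\<integral>s. \<sigma> * (s - a) \<partial>M) = 0"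
      using integrable by (simp add: int mass space_M)
    moreover have "AE s in M. 0 \<le> \<sigma> * (s - a)"
      using AE_T by eventually_elim (use pos in force)
    ultimately have "AE s in M. \<sigma> * (s - a) = 0"
      using integrable by (subst (asm) integral_nonneg_eq_0_iff_AE) auto
    then have "AE s in M. False"
      using AE_T by eventually_elim (use pos in force)
    then have "emeasure M (space M) = 0"
      by (simp add: AE_iff_measurable[OF _ refl] space_M)
    then show ?thesis
      using mass by (simp add: measure_def space_M u_def)
  qed
  have "E {a<..} x = 0"
    by (rule half[of _ 1]) auto
  moreover have "E {..<a} x = 0"
    by (rule half[of _ "- 1"]) auto
  ultimately have "emeasure (spectral_scalar_measure E x) ({a<..} \<union> {..<a}) \<le> 0"
    using emeasure_subadditive[of "{a<..}" "spectral_scalar_measure E x" "{..<a}"]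
    by (simp add: sets_spectral_scalar_measure emeasure_spectral_scalar_measure)
  moreover have "{a<..} \<union> {..<a} = - {a}"
    by auto
  ultimately have a: "E (- {a}) x = 0"
    by (simp add: emeasure_spectral_scalar_measure)
  have out: "E R x = 0" if "R \<in> sets borel" "a \<notin> R" for R
  proof -
    have "R \<inter> - {a} = R"
      using that by auto
    then show ?thesis
      using pvm_Int[of R "- {a}" x] that a by simp
  qed
  show ?thesis
  proof (cases "a \<in> S")
    case True
    \<comment> \<open>\<open>E (- S) x = 0\<close> leaves \<open>E S x\<close> with the full norm of
      \<open>x\<close>, so the orthogonal rest \<open>y\<close> is 0.\<close>
    define y where "y = x - E S x"
    have "emeasure (spectral_scalar_measure E x) S + emeasure (spectral_scalar_measure E x) (- S) =
        emeasure (spectral_scalar_measure E x) UNIV"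
      using S by (subst plus_emeasure) (auto simp: sets_spectral_scalar_measure)
    then have norm: "(norm (E S x))\<^sup>2 = (norm x)\<^sup>2"
      using S True out[of "- S"] by (simp add: emeasure_spectral_scalar_measure pvm_UNIV)
    have "cinner (E S x) y = 0"
      using pvm_cinner[OF S S, of x x] by (simp add: y_def cinner.diff_right)
    then have "(norm x)\<^sup>2 = (norm (E S x))\<^sup>2 + (norm y)\<^sup>2"
      using norm_add_Pythagorean[of "E S x" y]
      by (simp add: y_def orthogonal_def inner_eq_Re_cinner)
    then show ?thesis
      using norm True by (simp add: y_def)
  qed (simp add: out S)
qed

end

section \<open>Functional calculus of diagonal operators\<close>

context resolution_of_identity
begin

text \<open>The scalar spectral measure as point masses \<open>(norm (P i x))\<^sup>2\<close> at
  \<open>l i\<close>. Pushing forward from the indices turns integrals into series and takes care of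
  repeated entries of \<open>l\<close>.\<close>

definition diag_measure :: "(nat \<Rightarrow> real) \<Rightarrow> 'h \<Rightarrow> real measure" where
  "diag_measure l x =
     distr (density (count_space UNIV) (\<lambda>i. ennreal ((norm (P i x))\<^sup>2))) borel l"

lemma emeasure_diag_measure:
  assumes S: "S \<in> sets borel"
  shows "emeasure (diag_measure l x) S = ennreal ((norm (spectral_projection l S x))\<^sup>2)"
proof -
  have "emeasure (diag_measure l x) S =
      (\<integral>\<^sup>+i. ennreal ((norm (P i x))\<^sup>2) * indicator (l -` S) i \<partial>count_space UNIV)"
    using S by (simp add: diag_measure_def emeasure_distr emeasure_density)
  also have "\<dots> = (\<Sum>i. ennreal ((norm (P i x))\<^sup>2) * indicator (l -` S) i)"
    by (rule nn_integral_count_space_nat)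
  also have "\<dots> = (\<Sum>i. ennreal ((norm (P i (spectral_projection l S x)))\<^sup>2))"
    by (intro suminf_cong) (auto simp: P_spectral_projection)
  also have "\<dots> = ennreal ((norm (spectral_projection l S x))\<^sup>2)"
    by (intro suminf_ennreal_eq norm_sums) simp
  finally show ?thesis .
qed

lemma nn_integral_diag_measure:
  assumes [measurable]: "g \<in> borel_measurable borel"
  shows "(\<integral>\<^sup>+s. ennreal ((cmod (g s))\<^sup>2) \<partial>diag_measure l x) =
    (\<Sum>i. ennreal ((cmod (g (l i)) * norm (P i x))\<^sup>2))"
proof -
  have "(\<integral>\<^sup>+s. ennreal ((cmod (g s))\<^sup>2) \<partial>diag_measure l x) =
      (\<integral>\<^sup>+i. ennreal ((norm (P i x))\<^sup>2) * ennreal ((cmod (g (l i)))\<^sup>2) \<partial>count_space UNIV)"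
    unfolding diag_measure_def by (simp add: nn_integral_distr nn_integral_density)
  also have "\<dots> = (\<Sum>i. ennreal ((norm (P i x))\<^sup>2) * ennreal ((cmod (g (l i)))\<^sup>2))"
    by (rule nn_integral_count_space_nat)
  finally show ?thesis
    by (simp add: power_mult_distrib mult.commute flip: ennreal_mult)
qed

lemma integral_diag_measure:
  assumes g [measurable]: "g \<in> borel_measurable borel" and x: "x \<in> dom (diag (\<lambda>i. g (l i)))"
  shows "(\<integral>s. g s \<partial>diag_measure l x) = cinner (the (diag (\<lambda>i. g (l i)) x)) x"
proof -
  have "(\<integral>s. g s \<partial>diag_measure l x) =
      (\<integral>i. (norm (P i x))\<^sup>2 *\<^sub>R g (l i) \<partial>count_space UNIV)"
    unfolding diag_measure_def by (simp add: integral_distr integral_density)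
  also have "\<dots> = (\<Sum>i. (norm (P i x))\<^sup>2 *\<^sub>R g (l i))"
  proof (rule integral_count_space_nat)
    have "summable (\<lambda>i. norm ((norm (P i x))\<^sup>2 *\<^sub>R g (l i)))"
    proof (rule summable_comparison_test)
      show "summable (\<lambda>i. (cmod (g (l i)) * norm (P i x))\<^sup>2 + (norm (P i x))\<^sup>2)"
        using x norm_sums[of x] by (intro summable_add) (auto simp: dom_diag sums_iff)
      \<comment> \<open>With weights of finite sum, square summability implies absolute summability,
        by \<open>c \<le> c\<^sup>2 + 1\<close>.\<close>
      have "c * d\<^sup>2 \<le> (c * d)\<^sup>2 + d\<^sup>2" if "0 \<le> c" for c d :: real
      proof -
        have "c \<le> c\<^sup>2 + 1"
          using sum_squares_bound[of c 1] that by simp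
        then have "c * d\<^sup>2 \<le> (c\<^sup>2 + 1) * d\<^sup>2"
          by (rule mult_right_mono) simp
        then show ?thesis
          by (simp add: power_mult_distrib algebra_simps)
      qed
      then show "\<exists>N. \<forall>i\<ge>N. norm (norm ((norm (P i x))\<^sup>2 *\<^sub>R g (l i)))
          \<le> (cmod (g (l i)) * norm (P i x))\<^sup>2 + (norm (P i x))\<^sup>2"
        by (simp add: mult.commute)
    qed
    then show "integrable (count_space UNIV) (\<lambda>i. (norm (P i x))\<^sup>2 *\<^sub>R g (l i))"
      by (simp only: integrable_count_space_nat_iff)
  qed
  also have "\<dots> = (\<Sum>i. cinner (P i (the (diag (\<lambda>i. g (l i)) x))) x)"
  proof (rule suminf_cong)
    fix i
    have "cinner (P i x) x = complex_of_real ((norm (P i x))\<^sup>2)"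
      using orth[of i x i x] by (simp add: cinner_self)
    then show "(norm (P i x))\<^sup>2 *\<^sub>R g (l i) = cinner (P i (the (diag (\<lambda>i. g (l i)) x))) x"
      using P_diag[OF x, of i] by (simp add: cinner_scaleC_left scaleR_conv_of_real mult.commute)
  qed
  also have "\<dots> = cinner (the (diag (\<lambda>i. g (l i)) x)) x"
    using cinner_sums sums_unique by metis
  finally show ?thesis .
qed

lemma blinfun_eqI_P:
  fixes S T :: "'h \<Rightarrow>\<^sub>L 'h"
  assumes "\<And>i x. S (P i x) = T (P i x)"
  shows "S = T"
proof (rule blinfun_eqI)
  fix x
  have "(\<lambda>i. S (P i x)) sums S x" "(\<lambda>i. T (P i x)) sums T x"
    by (intro bounded_linear.sums[OF blinfun.bounded_linear_right] complete)+
  then show "S x = T x"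
    using assms sums_unique2 by simp
qed

text \<open>Each \<open>P i x\<close> is an eigenvector for \<open>l i\<close>, so every spectral
  measure of the operator is forced on it, and sums of these vectors are dense.\<close>

lemma spectral_measure_diag:
  assumes E: "projection_valued_measure E"
    and A: "is_spectral_integral E complex_of_real (diag (\<lambda>i. complex_of_real (l i)))"
    and S: "S \<in> sets borel"
  shows "E S = spectral_projection l S"
proof (rule blinfun_eqI_P)
  fix i x
  have "diag (\<lambda>i. complex_of_real (l i)) (P i x) = Some (complex_of_real (l i) *\<^sub>C P i x)"
    by (rule diag_P)
  then show "E S (P i x) = spectral_projection l S (P i x)"
    using spectral_projection_eigenvector[OF E A _ S] by (simp add: spectral_projection_P)
qed

text \<open>A projection-valued measure is constrained on Borel sets only, so \<open>E\<close>
  itself cannot be identified with \<open>spectral_projection l\<close>. Agreement on Borel sets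
  fixes the scalar measures, and a spectral integral depends on nothing else.\<close>

lemma is_spectral_integral_iff:
  assumes E: "projection_valued_measure E"
    and ES: "\<And>S. S \<in> sets borel \<Longrightarrow> E S = spectral_projection l S"
    and g: "g \<in> borel_measurable borel"
  shows "is_spectral_integral E g B \<longleftrightarrow> B = diag (\<lambda>i. g (l i))"
proof -
  have M: "spectral_scalar_measure E x = diag_measure l x" for x
  proof (rule measure_eqI)
    show sets: "sets (spectral_scalar_measure E x) = sets (diag_measure l x)"
      using E by (simp add: sets_spectral_scalar_measure diag_measure_def)
    fix S assume "S \<in> sets (spectral_scalar_measure E x)"
    then have "S \<in> sets borel"
      using E by (simp add: sets_spectral_scalar_measure)
    then show "emeasure (spectral_scalar_measure E x) S = emeasure (diag_measure l x) S"
      using E by (simp add: emeasure_spectral_scalar_measure emeasure_diag_measure ES)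
  qed
  have dom: "{x. (\<integral>\<^sup>+s. ennreal ((cmod (g s))\<^sup>2) \<partial>diag_measure l x) < \<infinity>} = dom (diag (\<lambda>i. g (l i)))"
  proof -
    have "(\<Sum>i. ennreal (h i)) < \<infinity> \<longleftrightarrow> summable h" if "\<And>i. 0 \<le> h i" for h :: "nat \<Rightarrow> real"
      unfolding infinity_ennreal_def less_top[symmetric]
      using summable_suminf_not_top[of h] ennreal_suminf_neq_top[of h] that by blast
    then show ?thesis
      by (simp add: nn_integral_diag_measure[OF g] dom_diag)
  qed
  show ?thesis
  proof
    assume B: "is_spectral_integral E g B"
    show "B = diag (\<lambda>i. g (l i))"
    proof (rule sym, rule linear_operator_eqI[OF linear_operator_diag _ _ closure_dom_diag])
      show "linear_operator B" "dom (diag (\<lambda>i. g (l i))) = dom B"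
        using B by (auto simp only: is_spectral_integral_def M dom)
      show "cinner (the (diag (\<lambda>i. g (l i)) x)) x = cinner (the (B x)) x"
        if x: "x \<in> dom (diag (\<lambda>i. g (l i)))" for x
        using B x integral_diag_measure[OF g x] by (simp only: is_spectral_integral_def M dom)
    qed
  next
    assume "B = diag (\<lambda>i. g (l i))"
    then show "is_spectral_integral E g B"
      unfolding is_spectral_integral_def M dom
      using linear_operator_diag integral_diag_measure[OF g] by simp
  qed
qed

lemma fun_calc_diag:
  assumes f: "f \<in> borel_measurable borel"
  shows "fun_calc f (diag (\<lambda>i. complex_of_real (l i))) = diag (\<lambda>i. f (l i))"
  unfolding fun_calc_def
proof (rule the_equality)
  have "is_spectral_integral (spectral_projection l) g (diag (\<lambda>i. g (l i)))"
    if "g \<in> borel_measurable borel" for g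
    using is_spectral_integral_iff[OF projection_valued_measure_spectral_projection _ that] by simp
  then show "\<exists>E. projection_valued_measure E \<and>
      is_spectral_integral E complex_of_real (diag (\<lambda>i. complex_of_real (l i))) \<and>
      is_spectral_integral E f (diag (\<lambda>i. f (l i)))"
    using f projection_valued_measure_spectral_projection by (intro exI[of _ "spectral_projection l"]) simp
next
  fix B
  assume "\<exists>E. projection_valued_measure E \<and>
      is_spectral_integral E complex_of_real (diag (\<lambda>i. complex_of_real (l i))) \<and>
      is_spectral_integral E f B"
  then obtain E where E: "projection_valued_measure E"
    "is_spectral_integral E complex_of_real (diag (\<lambda>i. complex_of_real (l i)))"
    and B: "is_spectral_integral E f B"
    by blast
  show "B = diag (\<lambda>i. f (l i))"
    using B is_spectral_integral_iff[OF E(1) spectral_measure_diag[OF E] f] by simp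
qed

text \<open>This keeps the perturbed operators in the diagonal family, where the functional calculus
  has been computed.\<close>

lemma add_bounded_diag:
  "add_bounded (diag (\<lambda>i. complex_of_real (l i))) (t *\<^sub>R P j) =
   diag (\<lambda>i. complex_of_real ((l(j := l j + t)) i))"
proof
  fix x
  define l' where "l' = l(j := l j + t)"
  have "add_bounded (diag (\<lambda>i. complex_of_real (l i))) (t *\<^sub>R P j) x = Some w \<longleftrightarrow>
      diag (\<lambda>i. complex_of_real (l' i)) x = Some w" for w
  proof -
    have "add_bounded (diag (\<lambda>i. complex_of_real (l i))) (t *\<^sub>R P j) x = Some w \<longleftrightarrow>
        diag (\<lambda>i. complex_of_real (l i)) x = Some (w - t *\<^sub>R P j x)"
      by (auto simp: add_bounded_def blinfun.scaleR_left)
    also have "\<dots> \<longleftrightarrow> (\<forall>i. P i w = complex_of_real (l' i) *\<^sub>C P i x)"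
      unfolding diag_eq_Some_iff
    proof (rule iff_allI)
      fix i
      have "P i (w - t *\<^sub>R P j x) = P i w - (if i = j then t *\<^sub>R P i x else 0)"
        by (simp add: blinfun.diff_right blinfun.scaleR_right P_P)
      then show "P i (w - t *\<^sub>R P j x) = complex_of_real (l i) *\<^sub>C P i x \<longleftrightarrow>
          P i w = complex_of_real (l' i) *\<^sub>C P i x"
        by (auto simp: l'_def scaleC_add_left scaleC_of_real algebra_simps)
    qed
    finally show ?thesis
      by (simp add: diag_eq_Some_iff)
  qed
  then show "add_bounded (diag (\<lambda>i. complex_of_real (l i))) (t *\<^sub>R P j) x =
      diag (\<lambda>i. complex_of_real ((l(j := l j + t)) i)) x"
    unfolding l'_def by (metis not_Some_eq)
qed

text \<open>The definite description is resolved on the vectors \<open>P i x\<close>: they lie in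
  both domains whatever \<open>g\<close> is, and a bounded operator is determined by its values on
  them.\<close>

lemma bounded_difference_diag:
  "bounded_difference (diag (g(j := g j + c))) (diag g) = scaleC_op c (P j)"
  unfolding bounded_difference_def
proof (rule the_equality)
  have "scaleC_op c (P j) x = the (diag (g(j := g j + c)) x) - the (diag g x)"
    if "x \<in> dom (diag (g(j := g j + c)))" "x \<in> dom (diag g)" for x
    using that
    by (intro P_eqI[where x = "blinfun_apply (scaleC_op c (P j)) x"])
      (simp add: scaleC_op.rep_eq clinear P_P P_diag blinfun.diff_right scaleC_add_left)
  moreover have "clinear_op (scaleC_op c (P j))"
    by (simp add: clinear_op_def scaleC_op.rep_eq clinear scaleC_scaleC mult.commute)
  ultimately show "clinear_op (scaleC_op c (P j)) \<and>
      (\<forall>x\<in>dom (diag (g(j := g j + c))) \<inter> dom (diag g).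
        scaleC_op c (P j) x = the (diag (g(j := g j + c)) x) - the (diag g x))"
    by blast
next
  fix T
  assume T: "clinear_op T \<and> (\<forall>x\<in>dom (diag (g(j := g j + c))) \<inter> dom (diag g).
      T x = the (diag (g(j := g j + c)) x) - the (diag g x))"
  show "T = scaleC_op c (P j)"
  proof (rule blinfun_eqI_P)
    fix i x
    have "T (P i x) = the (diag (g(j := g j + c)) (P i x)) - the (diag g (P i x))"
      using T P_in_dom_diag by blast
    then show "T (P i x) = scaleC_op c (P j) (P i x)"
      by (simp add: diag_P scaleC_op.rep_eq P_P scaleC_add_left)
  qed
qed

lemma op_increment_diag:
  assumes "f \<in> borel_measurable borel"
  shows "op_increment f (diag (\<lambda>i. complex_of_real (l i))) (t *\<^sub>R P j) =
    scaleC_op (f (l j + t) - f (l j)) (P j)"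
proof -
  have "(\<lambda>i. f ((l(j := l j + t)) i)) = (\<lambda>i. f (l i))(j := f (l j) + (f (l j + t) - f (l j)))"
    by auto
  then show ?thesis
    using bounded_difference_diag[of "\<lambda>i. f (l i)" j "f (l j + t) - f (l j)"]
    by (simp only: op_increment_def add_bounded_diag fun_calc_diag[OF assms])
qed

end

section \<open>A resolution of the identity with projections of rank one\<close>

text \<open>The shift by one reserves \<open>P 0\<close> for the complement of the closed span of
  the \<open>e j\<close>; it may be 0 or of infinite rank.\<close>

locale rank_one_resolution = resolution_of_identity P
  for P :: "nat \<Rightarrow> 'h::complex_hilbert_space \<Rightarrow>\<^sub>L 'h" +
  fixes e :: "nat \<Rightarrow> 'h"
  assumes norm_e: "norm (e j) = 1"
    and P_Suc: "P (Suc j) x = cinner x (e j) *\<^sub>C e j"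

text \<open>\<open>Q\<close> is the projection onto the closed span, given by the Fourier series;
  Bessel's inequality makes the series converge and bounds \<open>Q\<close> by 1. The residual
  \<open>x - Q x\<close> becomes \<open>P 0\<close>.\<close>

lemma ex_rank_one_resolution:
  assumes "\<not> (\<exists>B :: 'h::complex_hilbert_space set. finite B \<and> complex_vector.span B = UNIV)"
  shows "\<exists>(P :: nat \<Rightarrow> 'h \<Rightarrow>\<^sub>L 'h) e. rank_one_resolution P e"
proof -
  obtain e :: "nat \<Rightarrow> 'h" where e: "\<And>i j. cinner (e i) (e j) = (if i = j then 1 else 0)"
    using ex_orthonormal_sequence[OF assms] by blast
  have norm_e: "norm (e j) = 1" for j
  proof -
    have "(norm (e j))\<^sup>2 = 1\<^sup>2"
      using e[of j j] unfolding cinner_self by (simp only: of_real_eq_1_iff power_one simp_thms if_True)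
    then show ?thesis
      by (simp only: power2_eq_iff_nonneg norm_ge_zero zero_le_one)
  qed
  define Q where "Q = (\<lambda>x. \<Sum>j. cinner x (e j) *\<^sub>C e j)"
  have bessel: "norm (\<Sum>j\<in>J. cinner x (e j) *\<^sub>C e j) \<le> norm x" if "finite J" for x J
  proof -
    define s where "s = (\<Sum>j\<in>J. cinner x (e j) *\<^sub>C e j)"
    have "cinner s (e i) = cinner x (e i)" if "i \<in> J" for i
    proof -
      have "cinner s (e i) = (\<Sum>j\<in>J. if j = i then cinner x (e i) else 0)"
        unfolding s_def cinner.sum_left by (intro sum.cong) (auto simp: cinner_scaleC_left e)
      then show ?thesis
        using that \<open>finite J\<close> by simp
    qed
    then have "cinner (x - s) s = 0"
      by (simp add: s_def[symmetric] cinner.diff_left)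
        (simp add: s_def cinner.sum_right cinner_scaleC_right)
    then have "(norm x)\<^sup>2 = (norm (x - s))\<^sup>2 + (norm s)\<^sup>2"
      using norm_add_Pythagorean[of "x - s" s] by (simp add: orthogonal_def inner_eq_Re_cinner)
    then have "(norm s)\<^sup>2 \<le> (norm x)\<^sup>2"
      by simp
    then show ?thesis
      unfolding s_def[symmetric] by (rule power2_le_imp_le) simp
  qed
  have Q: "(\<lambda>j. cinner x (e j) *\<^sub>C e j) sums Q x" for x
  proof -
    have orth: "cinner (cinner x (e i) *\<^sub>C e i) (cinner x (e j) *\<^sub>C e j) = 0" if "i \<noteq> j" for i j
      using that by (simp add: cinner_scaleC_left cinner_scaleC_right e)
    have "summable (\<lambda>j. (norm (cinner x (e j) *\<^sub>C e j))\<^sup>2)"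
    proof (rule bounded_imp_summable)
      show "(\<Sum>j\<le>n. (norm (cinner x (e j) *\<^sub>C e j))\<^sup>2) \<le> (norm x)\<^sup>2" for n
        using power_mono[OF bessel[of "{..n}" x] norm_ge_zero, of 2]
          norm_sum_orthogonal[of "\<lambda>j. cinner x (e j) *\<^sub>C e j" "{..n}", OF orth]
        by simp
    qed simp
    then show ?thesis
      unfolding Q_def using orth by (intro summable_sums summable_orthogonal)
  qed
  have norm_Q: "norm (Q x) \<le> norm x" for x
    using Q[of x] bessel[of "{..<n}" x for n] unfolding sums_def
    by (intro tendsto_le[OF _ tendsto_const tendsto_norm, of sequentially _ "Q x"]) auto
  have Q_add: "Q (x + y) = Q x + Q y" for x y
    by (rule sums_unique2[OF Q]) (use sums_add[OF Q Q] in \<open>simp add: cinner_add_left scaleC_add_left\<close>)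
  have Q_scale: "Q (c *\<^sub>C x) = c *\<^sub>C Q x" for c x
    by (rule sums_unique2[OF Q])
      (use bounded_linear.sums[OF scaleC.bounded_linear_right Q] in
        \<open>simp add: cinner_scaleC_left scaleC_scaleC\<close>)
  have Q_scaleR: "Q (r *\<^sub>R x) = r *\<^sub>R Q x" for r x
    using Q_scale[of "complex_of_real r" x] by (simp add: scaleC_of_real)
  have Q_e: "cinner (Q x) (e i) = cinner x (e i)" for x i
  proof -
    have "(\<lambda>j. cinner (cinner x (e j) *\<^sub>C e j) (e i)) sums cinner (Q x) (e i)"
      by (intro bounded_linear.sums[OF cinner.bounded_linear_left] Q)
    moreover have "cinner (cinner x (e j) *\<^sub>C e j) (e i) = (if j = i then cinner x (e i) else 0)" for j
      by (simp add: cinner_scaleC_left e)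
    ultimately show ?thesis
      using sums_single[of i "\<lambda>_. cinner x (e i)"] sums_unique2 by simp
  qed
  have Q_orth: "cinner (x - Q x) (Q y) = 0" for x y
  proof -
    have "(\<lambda>j. cinner (x - Q x) (cinner y (e j) *\<^sub>C e j)) sums cinner (x - Q x) (Q y)"
      by (intro bounded_linear.sums[OF cinner.bounded_linear_right] Q)
    moreover have "cinner (x - Q x) (cinner y (e j) *\<^sub>C e j) = 0" for j
      by (simp add: cinner_scaleC_right cinner.diff_left Q_e)
    ultimately show ?thesis
      by (simp only: sums_0 sums_unique2[OF sums_zero, symmetric])
  qed
  define P where "P i = (case i of 0 \<Rightarrow> Blinfun (\<lambda>x. x - Q x)
    | Suc j \<Rightarrow> Blinfun (\<lambda>x. cinner x (e j) *\<^sub>C e j))" for i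
  have P_0: "P 0 x = x - Q x" for x
  proof -
    have "bounded_linear Q"
      by (rule bounded_linear_intro[where K = 1]) (simp_all add: Q_add Q_scaleR norm_Q)
    then show ?thesis
      by (simp add: P_def bounded_linear_Blinfun_apply bounded_linear_sub bounded_linear_ident)
  qed
  have P_Suc: "P (Suc j) x = cinner x (e j) *\<^sub>C e j" for j x
  proof -
    have "bounded_linear (\<lambda>x. cinner x (e j) *\<^sub>C e j)"
      by (rule bounded_linear_compose[OF scaleC.bounded_linear_left cinner.bounded_linear_left])
    then show ?thesis
      by (simp add: P_def bounded_linear_Blinfun_apply)
  qed
  have "rank_one_resolution P e"
  proof
    show "P i (c *\<^sub>C x) = c *\<^sub>C P i x" for i c x
      by (cases i) (simp_all add: P_0 P_Suc Q_scale scaleC.diff_right cinner_scaleC_left scaleC_scaleC)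
    show "cinner (P i x) (P j y) = (if i = j then cinner (P i x) y else 0)" for i j x y
    proof (cases i; cases j)
      fix k assume "i = 0" "j = Suc k"
      then show ?thesis
        by (simp add: P_0 P_Suc cinner_scaleC_right cinner.diff_left Q_e)
    next
      fix k assume "i = Suc k" "j = 0"
      moreover have "cinner (e k) (y - Q y) = 0"
        using cinner_commute[of "e k" "y - Q y"] by (simp add: cinner.diff_left Q_e)
      ultimately show ?thesis
        by (simp add: P_0 P_Suc cinner_scaleC_left)
    next
      assume "i = 0" "j = 0"
      then show ?thesis
        using Q_orth[of x y] by (simp add: P_0 cinner.diff_right)
    next
      fix k m assume "i = Suc k" "j = Suc m"
      then show ?thesis
        by (auto simp: P_Suc cinner_scaleC_left cinner_scaleC_right e
            cinner_commute[of "e m" y, symmetric])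
    qed
    show "(\<lambda>i. P i x) sums x" for x
      using sums_Suc[of "\<lambda>i. P i x" "Q x"] Q[of x] by (simp add: P_0 P_Suc)
  qed (simp_all add: norm_e P_Suc)
  then show ?thesis
    by blast
qed

section \<open>Schatten norms of operators of rank one\<close>

lemma singular_value_le:
  "clinear_op F \<Longrightarrow> rank_le k F \<Longrightarrow> singular_value k T \<le> norm (T - F)"
  unfolding singular_value_def by (rule cInf_lower) (auto intro!: bdd_belowI[of _ 0])

lemma clinear_op_0: "clinear_op 0" and rank_le_0: "rank_le k 0"
  by (auto simp: clinear_op_def rank_le_def intro!: exI[of _ "{}"])

lemma singular_value_nonneg: "0 \<le> singular_value k T"
  unfolding singular_value_def
  by (rule cInf_greatest) (use clinear_op_0 rank_le_0 in blast, auto)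

lemma singular_value_0: "singular_value 0 T = norm T"
proof -
  have "F = 0" if "rank_le 0 F" for F :: "'h::complex_hilbert_space \<Rightarrow>\<^sub>L 'h"
    using that by (intro blinfun_eqI) (auto simp: rank_le_def image_subset_iff)
  then have "{norm (T - F) | F. clinear_op F \<and> rank_le 0 F} = {norm T}"
    using clinear_op_0 rank_le_0 by force
  then show ?thesis
    by (simp add: singular_value_def)
qed

text \<open>The operator norm is the singular value with number 0, a single term of the series.
  Every remainder estimate passes to the operator norm through this inequality.\<close>

lemma norm_le_schatten_norm:
  assumes "T \<in> schatten p" "1 < p"
  shows "norm T \<le> schatten_norm p T"
proof -
  have "norm T powr p \<le> (\<Sum>k. singular_value k T powr p)"
    using assms sum_le_suminf[of "\<lambda>k. singular_value k T powr p" "{0}"]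
    by (simp add: schatten_def singular_value_0)
  then have "(norm T powr p) powr (1 / p) \<le> schatten_norm p T"
    unfolding schatten_norm_def using assms(2) by (intro powr_mono2) auto
  then show ?thesis
    using assms(2) by (simp add: powr_powr)
qed

locale rank_one =
  fixes R :: "'h::complex_hilbert_space \<Rightarrow>\<^sub>L 'h" and e :: 'h
  assumes norm_e: "norm e = 1" and R_apply: "R x = cinner x e *\<^sub>C e"
begin

lemma clinear_scaleC_R: "clinear_op (scaleC_op c R)"
  by (simp add: clinear_op_def scaleC_op.rep_eq R_apply cinner_scaleC_left scaleC_scaleC ac_simps)

lemma rank_le_scaleC_R: "rank_le (Suc k) (scaleC_op c R)"
  unfolding rank_le_def
proof (intro exI conjI)
  show "range (scaleC_op c R) \<subseteq> complex_vector.span {e}"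
  proof clarify
    fix x
    show "scaleC_op c R x \<in> complex_vector.span {e}"
      unfolding scaleC_op.rep_eq R_apply
      by (intro complex_vector.span_scale complex_vector.span_base) simp
  qed
qed auto

lemma R_e: "R e = e"
  by (simp add: R_apply cinner_self norm_e)

lemma norm_scaleC_R: "norm (scaleC_op c R) = cmod c"
proof (rule antisym)
  show "norm (scaleC_op c R) \<le> cmod c"
  proof (rule norm_blinfun_bound)
    show "norm (scaleC_op c R x) \<le> cmod c * norm x" for x
      using norm_cinner_le[of x e]
      by (simp add: scaleC_op.rep_eq R_apply norm_scaleC norm_e norm_mult mult_left_mono)
  qed simp
  show "cmod c \<le> norm (scaleC_op c R)"
    using norm_blinfun[of "scaleC_op c R" e] by (simp add: scaleC_op.rep_eq R_e norm_scaleC norm_e)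
qed

lemma singular_value_scaleC_R: "singular_value k (scaleC_op c R) = (if k = 0 then cmod c else 0)"
proof (cases k)
  case (Suc m)
  have "singular_value k (scaleC_op c R) \<le> 0"
    using singular_value_le[OF clinear_scaleC_R rank_le_scaleC_R[of m c], of "scaleC_op c R"] Suc
    by simp
  then show ?thesis
    using singular_value_nonneg[of k "scaleC_op c R"] Suc by simp
qed (simp add: singular_value_0 norm_scaleC_R)

lemma schatten_sums: "(\<lambda>k. singular_value k (scaleC_op c R) powr p) sums (cmod c powr p)"
  using sums_single[of 0 "\<lambda>_. cmod c powr p"]
  by (simp add: singular_value_scaleC_R if_distrib[of "\<lambda>x. x powr p"] cong: if_cong)

lemma scaleC_R_in_schatten: "scaleC_op c R \<in> schatten p"
  using schatten_sums[of c p] by (simp add: schatten_def clinear_scaleC_R sums_iff)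

lemma schatten_norm_scaleC_R: "1 < p \<Longrightarrow> schatten_norm p (scaleC_op c R) = cmod c"
  using schatten_sums[of c p] by (simp add: schatten_norm_def sums_iff powr_powr)

lemma scaleC_R_of_real: "scaleC_op (complex_of_real t) R = t *\<^sub>R R"
  by (rule blinfun_eqI) (simp add: scaleC_op.rep_eq scaleC_of_real blinfun.scaleR_left)

lemma scaleR_R_in_schatten_sa: "t *\<^sub>R R \<in> schatten_sa p"
proof -
  have "selfadjoint_op (t *\<^sub>R R)"
    unfolding selfadjoint_op_def
    by (auto simp: blinfun.scaleR_left R_apply cinner_scaleR_left cinner_scaleR_right
        cinner_scaleC_left cinner_scaleC_right) (metis cinner_commute)
  then show ?thesis
    using scaleC_R_in_schatten[of "complex_of_real t" p] by (simp add: schatten_sa_def scaleC_R_of_real)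
qed

lemma R_in_schatten_sa: "R \<in> schatten_sa p"
  using scaleR_R_in_schatten_sa[of 1 p] by simp

lemma schatten_norm_scaleR_R: "1 < p \<Longrightarrow> schatten_norm p (t *\<^sub>R R) = \<bar>t\<bar>"
  using schatten_norm_scaleC_R[of p "complex_of_real t"] by (simp add: scaleC_R_of_real)

lemma schatten_norm_R: "1 < p \<Longrightarrow> schatten_norm p R = 1"
  using schatten_norm_scaleR_R[of p 1] by simp

text \<open>If \<open>F\<close> of rank at most \<open>k\<close> approximates \<open>D\<close>, then
  \<open>scaleC_op c R - F\<close> has rank at most \<open>Suc k\<close> and approximates
  \<open>scaleC_op c R - D\<close> equally well, so the singular values shift by at most one place.
  A Schatten derivative is defined through the norm of a remainder whose membership in the class is
  not part of the definition; it is obtained here.\<close>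

lemma scaleC_R_diff_in_schatten:
  assumes D: "D \<in> schatten p" and p: "1 < p"
  shows "scaleC_op c R - D \<in> schatten p"
proof -
  have clin: "clinear_op (scaleC_op c R - F)" if "clinear_op F" for F
    using that clinear_scaleC_R[of c]
    by (simp add: clinear_op_def blinfun.diff_left scaleC.diff_right)
  have rank: "rank_le (Suc k) (scaleC_op c R - F)" if F: "rank_le k F" for k F
  proof -
    obtain B where B: "finite B" "card B \<le> k" "range F \<subseteq> complex_vector.span B"
      using F by (auto simp: rank_le_def)
    show ?thesis
      unfolding rank_le_def
    proof (intro exI conjI)
      show "finite (insert e B)" "card (insert e B) \<le> Suc k"
        using B card_insert_le_m1[of "Suc k" B e] by (auto simp: card_insert_if)
      show "range (scaleC_op c R - F) \<subseteq> complex_vector.span (insert e B)"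
      proof
        fix y assume "y \<in> range (scaleC_op c R - F)"
        then obtain x where y: "y = c *\<^sub>C (cinner x e *\<^sub>C e) - F x"
          by (auto simp: blinfun.diff_left scaleC_op.rep_eq R_apply)
        have "F x \<in> complex_vector.span (insert e B)"
          using B(3) complex_vector.span_mono[of B "insert e B"] by blast
        then show "y \<in> complex_vector.span (insert e B)"
          unfolding y by (intro complex_vector.span_diff complex_vector.span_scale)
            (auto intro: complex_vector.span_base)
      qed
    qed
  qed
  have le: "singular_value (Suc k) (scaleC_op c R - D) \<le> singular_value k D" for k
    unfolding singular_value_def[of k D]
  proof (rule cInf_greatest)
    show "{norm (D - F) |F. clinear_op F \<and> rank_le k F} \<noteq> {}"
      using clinear_op_0 rank_le_0 by blast
    fix z assume "z \<in> {norm (D - F) |F. clinear_op F \<and> rank_le k F}"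
    then obtain F where F: "clinear_op F" "rank_le k F" "z = norm (D - F)" by blast
    have "scaleC_op c R - D - (scaleC_op c R - F) = - (D - F)"
      by simp
    then show "singular_value (Suc k) (scaleC_op c R - D) \<le> z"
      using singular_value_le[OF clin[OF F(1)] rank[OF F(2)], of "scaleC_op c R - D"]
      unfolding F(3) by (metis norm_minus_cancel)
  qed
  have "summable (\<lambda>k. singular_value (Suc k) (scaleC_op c R - D) powr p)"
  proof (rule summable_comparison_test)
    show "summable (\<lambda>k. singular_value k D powr p)"
      using D by (simp add: schatten_def)
    show "\<exists>N. \<forall>k\<ge>N. norm (singular_value (Suc k) (scaleC_op c R - D) powr p) \<le> singular_value k D powr p"
      using p le by (auto intro!: powr_mono2 simp: singular_value_nonneg)
  qed
  then have "summable (\<lambda>k. singular_value k (scaleC_op c R - D) powr p)"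
    by (subst (asm) summable_Suc_iff)
  then show ?thesis
    using clin D by (simp add: schatten_def)
qed

end

section \<open>Derivatives of functions of a real variable\<close>

lemma has_vector_derivative_iff_tendsto:
  fixes g :: "real \<Rightarrow> 'a::real_normed_vector"
  shows "(g has_vector_derivative d) (at t) \<longleftrightarrow> ((\<lambda>h. (1 / h) *\<^sub>R (g (t + h) - g t)) \<longlongrightarrow> d) (at 0)"
proof -
  have "(g has_vector_derivative d) (at t) \<longleftrightarrow>
      ((\<lambda>h. norm (g (t + h) - g t - h *\<^sub>R d) / norm h) \<longlongrightarrow> 0) (at 0)"
    by (simp add: has_vector_derivative_def has_derivative_at bounded_linear_scaleR_left)
  also have "\<dots> \<longleftrightarrow> ((\<lambda>h. norm ((1 / h) *\<^sub>R (g (t + h) - g t) - d)) \<longlongrightarrow> 0) (at 0)"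
  proof (rule tendsto_cong)
    have "norm (g (t + h) - g t - h *\<^sub>R d) / norm h = norm ((1 / h) *\<^sub>R (g (t + h) - g t) - d)"
      if "h \<noteq> 0" for h
    proof -
      have "(1 / h) *\<^sub>R (g (t + h) - g t) - d = (1 / h) *\<^sub>R (g (t + h) - g t - h *\<^sub>R d)"
        using that by (simp add: scaleR_diff_right)
      then show ?thesis
        by simp
    qed
    then show "\<forall>\<^sub>F h in at 0. norm (g (t + h) - g t - h *\<^sub>R d) / norm h =
        norm ((1 / h) *\<^sub>R (g (t + h) - g t) - d)"
      by (simp add: eventually_at_filter)
  qed
  finally show ?thesis
    by (simp add: tendsto_norm_zero_iff LIM_zero_iff)
qed

lemma nth_deriv_0 [simp]: "nth_deriv 0 f = f"
  by (simp add: nth_deriv_def)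

lemma nth_deriv_Suc: "nth_deriv (Suc k) f t = vector_derivative (nth_deriv k f) (at t)"
  by (simp add: nth_deriv_def)

lemma vector_derivative_increment:
  fixes g :: "real \<Rightarrow> 'a::real_normed_vector"
  assumes "\<And>t. g t = f (a + t) - c"
  shows "(g has_vector_derivative d) (at t) \<longleftrightarrow> (f has_vector_derivative d) (at (a + t))"
  by (simp add: has_vector_derivative_iff_tendsto assms add.assoc)

text \<open>Valid also where derivatives do not exist: \<open>vector_derivative\<close> chooses from
  the same set of candidates on both sides. The constant \<open>f a\<close> survives at order 0
  only.\<close>

lemma nth_deriv_increment:
  "nth_deriv k (\<lambda>t. f (a + t) - f a) t = nth_deriv k f (a + t) - (if k = 0 then f a else 0)"
proof (induction k arbitrary: t)
  case (Suc k)
  show ?case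
    using vector_derivative_increment[of "nth_deriv k (\<lambda>t. f (a + t) - f a)", OF Suc]
    by (simp add: nth_deriv_Suc vector_derivative_def)
qed simp

lemma differentiable_increment:
  "nth_deriv k (\<lambda>t. f (a + t) - f a) differentiable (at 0) \<longleftrightarrow> nth_deriv k f differentiable (at a)"
proof -
  have "g differentiable (at t) \<longleftrightarrow> (\<exists>d. (g has_vector_derivative d) (at t))"
    for g :: "real \<Rightarrow> complex" and t
    using vector_derivative_works differentiableI_vector by blast
  then show ?thesis
    using vector_derivative_increment[of "nth_deriv k (\<lambda>t. f (a + t) - f a)", OF nth_deriv_increment,
        of _ 0] by simp
qed

section \<open>Derivatives along a projection of rank one\<close>

context rank_one
begin

lemma scaleC_op_diff: "scaleC_op (a - b) R = scaleC_op a R - scaleC_op b R"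
  by (rule blinfun_eqI) (simp add: scaleC_op.rep_eq blinfun.diff_left scaleC.diff_left)

lemma scaleR_scaleC_R: "r *\<^sub>R scaleC_op a R = scaleC_op (r *\<^sub>R a) R"
  by (rule blinfun_eqI) (simp add: scaleC_op.rep_eq blinfun.scaleR_left scaleC.scaleR_left)

text \<open>The multiples of \<open>R\<close> form a closed line, so the limit lies on it. The
  coefficient \<open>cinner (D e) e\<close> depends contractively on \<open>D\<close>, which turns
  convergence of operators into convergence of scalars.\<close>

lemma tendsto_scaleC_R:
  assumes lim: "((\<lambda>h. norm (scaleC_op (a h) R - D)) \<longlongrightarrow> 0) F" and F: "F \<noteq> bot"
  shows "\<exists>d. (a \<longlongrightarrow> d) F \<and> D = scaleC_op d R"
proof -
  define d where "d = cinner (D e) e"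
  have a: "norm (a h - d) \<le> norm (scaleC_op (a h) R - D)" for h
  proof -
    have "a h - d = cinner ((scaleC_op (a h) R - D) e) e"
      by (simp add: d_def blinfun.diff_left cinner.diff_left scaleC_op.rep_eq R_e
          cinner_scaleC_left cinner_self norm_e)
    also have "norm \<dots> \<le> norm ((scaleC_op (a h) R - D) e) * norm e"
      by (rule norm_cinner_le)
    also have "\<dots> \<le> norm (scaleC_op (a h) R - D)"
      using norm_blinfun[of "scaleC_op (a h) R - D" e] by (simp add: norm_e)
    finally show ?thesis .
  qed
  have "((\<lambda>h. a h - d) \<longlongrightarrow> 0) F"
    by (rule Lim_null_comparison[OF _ lim]) (simp add: a)
  then have ad: "(a \<longlongrightarrow> d) F"
    by (simp add: LIM_zero_iff)
  have "((\<lambda>h. norm (scaleC_op (a h) R - D) + norm (a h - d)) \<longlongrightarrow> 0) F"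
    using tendsto_add[OF lim tendsto_norm_zero[OF \<open>((\<lambda>h. a h - d) \<longlongrightarrow> 0) F\<close>]] by simp
  moreover have "norm (scaleC_op d R - D) \<le> norm (scaleC_op (a h) R - D) + norm (a h - d)" for h
  proof -
    have eq: "scaleC_op d R - D = (scaleC_op (a h) R - D) - scaleC_op (a h - d) R"
      by (simp add: scaleC_op_diff)
    show ?thesis
      unfolding eq using norm_triangle_ineq4[of "scaleC_op (a h) R - D" "scaleC_op (a h - d) R"]
      by (simp only: norm_scaleC_R)
  qed
  \<comment> \<open>The left side does not depend on \<open>h\<close>, so it is at most the limit of
    the right side; the filter must be nontrivial for this.\<close>
  ultimately have "norm (scaleC_op d R - D) \<le> 0"
    using F by (intro tendsto_lowerbound) auto
  then show ?thesis
    using ad by auto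
qed

text \<open>By induction on the order, the intermediate derivative \<open>\<psi>\<close> is a scalar
  derivative of \<open>g\<close> times \<open>R\<close> at all points near \<open>t\<close>, so its
  difference quotients are scalar multiples of \<open>R\<close> and \<open>tendsto_scaleC_R\<close>
  applies.\<close>

lemma has_nth_schatten_derivative_scaleC_R:
  assumes "has_nth_schatten_derivative p k (\<lambda>t. scaleC_op (g t) R) t D" and p: "1 < p"
  shows "D = scaleC_op (nth_deriv k g t) R \<and> (\<forall>m. k = Suc m \<longrightarrow> nth_deriv m g differentiable (at t))"
  using assms(1)
proof (induction k arbitrary: t D)
  case (Suc k)
  then obtain \<psi> where
    ev: "\<forall>\<^sub>F s in nhds t. has_nth_schatten_derivative p k (\<lambda>t. scaleC_op (g t) R) s (\<psi> s)"
    and D: "D \<in> schatten p"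
    and lim: "((\<lambda>h. schatten_norm p ((1 / h) *\<^sub>R (\<psi> (t + h) - \<psi> t) - D)) \<longlongrightarrow> 0) (at 0)"
    by (auto simp: has_schatten_derivative_def)
  define G where "G = nth_deriv k g"
  have \<psi>: "\<forall>\<^sub>F s in nhds t. \<psi> s = scaleC_op (G s) R"
    using ev Suc.IH by (auto simp: G_def elim: eventually_mono)
  then have \<psi>_t: "\<psi> t = scaleC_op (G t) R"
    by (rule eventually_nhds_x_imp_x)
  have "((\<lambda>h. t + h) \<longlongrightarrow> t + 0) (at 0)"
    by (intro tendsto_intros)
  then have "\<forall>\<^sub>F h in at 0. \<psi> (t + h) = scaleC_op (G (t + h)) R"
    using eventually_compose_filterlim[OF \<psi>, of "\<lambda>h. t + h"] by simp
  then have "\<forall>\<^sub>F h in at 0. norm (norm (scaleC_op ((1 / h) *\<^sub>R (G (t + h) - G t)) R - D))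
      \<le> schatten_norm p ((1 / h) *\<^sub>R (\<psi> (t + h) - \<psi> t) - D)"
  proof eventually_elim
    case (elim h)
    have "(1 / h) *\<^sub>R (\<psi> (t + h) - \<psi> t) = scaleC_op ((1 / h) *\<^sub>R (G (t + h) - G t)) R"
      by (simp add: elim \<psi>_t scaleC_op_diff[symmetric] scaleR_scaleC_R)
    then show ?case
      using norm_le_schatten_norm[OF scaleC_R_diff_in_schatten[OF D p] p] by simp
  qed
  then have "((\<lambda>h. norm (scaleC_op ((1 / h) *\<^sub>R (G (t + h) - G t)) R - D)) \<longlongrightarrow> 0) (at 0)"
    using lim by (rule Lim_null_comparison)
  from tendsto_scaleC_R[OF this] obtain d
    where "((\<lambda>h. (1 / h) *\<^sub>R (G (t + h) - G t)) \<longlongrightarrow> d) (at 0)" and D_eq: "D = scaleC_op d R"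
    by auto
  then have "(G has_vector_derivative d) (at t)"
    by (simp add: has_vector_derivative_iff_tendsto)
  then have "nth_deriv (Suc k) g t = d" "nth_deriv k g differentiable (at t)"
    by (simp_all add: nth_deriv_Suc G_def vector_derivative_at differentiableI_vector)
  then show ?case
    using D_eq by simp
qed simp

end

context rank_one_resolution
begin

lemma rank_one_P: "rank_one (P (Suc j)) (e j)"
  by unfold_locales (simp_all add: norm_e P_Suc)

abbreviation diag_real :: "(nat \<Rightarrow> real) \<Rightarrow> 'h operator" where
  "diag_real l \<equiv> diag (\<lambda>i. complex_of_real (l i))"

lemma gateaux_derivative_diag:
  assumes f: "f \<in> borel_measurable borel" and p: "1 < p"
    and D: "has_nth_schatten_derivative p (Suc k)
      (\<lambda>t. op_increment f (diag_real l) (t *\<^sub>R P (Suc j))) 0 D"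
  shows "D = scaleC_op (nth_deriv (Suc k) f (l (Suc j))) (P (Suc j))"
    "nth_deriv k f differentiable (at (l (Suc j)))"
proof -
  interpret rank_one "P (Suc j)" "e j"
    by (rule rank_one_P)
  show "D = scaleC_op (nth_deriv (Suc k) f (l (Suc j))) (P (Suc j))"
    "nth_deriv k f differentiable (at (l (Suc j)))"
    using has_nth_schatten_derivative_scaleC_R[OF D[unfolded op_increment_diag[OF f]] p]
    by (simp_all add: differentiable_increment nth_deriv_increment)
qed

lemma differentiable_if_gateaux:
  assumes f: "f \<in> borel_measurable borel" and p: "1 < p"
    and G: "gateaux_differentiable p f n (diag_real l)" and k: "k < n"
  shows "nth_deriv k f differentiable (at (l (Suc j)))"
proof -
  interpret rank_one "P (Suc j)" "e j"
    by (rule rank_one_P)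
  have "Suc k \<in> {1..n}"
    using k by simp
  then obtain \<Delta> where "has_nth_schatten_derivative p (Suc k)
      (\<lambda>t. op_increment f (diag_real l) (t *\<^sub>R P (Suc j))) 0 (\<Delta> (P (Suc j)))"
    using G R_in_schatten_sa[of p] unfolding gateaux_differentiable_def by blast
  then show ?thesis
    by (rule gateaux_derivative_diag[OF f p])
qed

text \<open>All the numbers \<open>nth_deriv k f (l (Suc j))\<close> are the Schatten norms of the values of one bounded
  homogeneous map at unit vectors.\<close>

lemma bounded_if_gateaux:
  assumes f: "f \<in> borel_measurable borel" and p: "1 < p"
    and G: "gateaux_differentiable p f n (diag_real l)" and k: "k \<in> {1..n}"
  shows "\<exists>C. \<forall>j. norm (nth_deriv k f (l (Suc j))) \<le> C"
proof -
  obtain \<Delta> C where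
    \<Delta>: "\<And>X. X \<in> schatten_sa p \<Longrightarrow>
      has_nth_schatten_derivative p k (\<lambda>t. op_increment f (diag_real l) (t *\<^sub>R X)) 0 (\<Delta> X)"
    and C: "\<And>X. X \<in> schatten_sa p \<Longrightarrow> schatten_norm p (\<Delta> X) \<le> C * schatten_norm p X ^ k"
    using G k unfolding gateaux_differentiable_def by metis
  have "norm (nth_deriv k f (l (Suc j))) \<le> C" for j
  proof -
    interpret rank_one "P (Suc j)" "e j"
      by (rule rank_one_P)
    obtain m where m: "k = Suc m"
      using k by (cases k) auto
    have "\<Delta> (P (Suc j)) = scaleC_op (nth_deriv k f (l (Suc j))) (P (Suc j))"
      using gateaux_derivative_diag(1)[OF f p \<Delta>[OF R_in_schatten_sa, unfolded m]] by (simp add: m)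
    then show ?thesis
      using C[OF R_in_schatten_sa] p by (simp add: schatten_norm_scaleC_R schatten_norm_R)
  qed
  then show ?thesis
    by blast
qed

section \<open>Frechet derivatives of diagonal operators\<close>

text \<open>The value of \<open>D\<close> on equal arguments is what drives the induction: it
  identifies the derivatives of order \<open>n\<close> at the perturbed operators, whence the
  generalization over \<open>l\<close>. In the second claim \<open>\<delta>\<close> is independent
  of \<open>j\<close> since all directions \<open>t *\<^sub>R P (Suc j)\<close> have Schatten norm
  \<open>\<bar>t\<bar>\<close> and the other arguments have norm 1.\<close>

lemma frechet_derivative_diag:
  assumes f: "f \<in> borel_measurable borel" and p: "1 < p"
    and "has_frechet_derivative p f (Suc n) (diag_real l) D"
  shows "\<forall>j. nth_deriv n f differentiable (at (l (Suc j))) \<and>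
      D (replicate (Suc n) (P (Suc j))) = scaleC_op (nth_deriv (Suc n) f (l (Suc j))) (P (Suc j))"
    "\<forall>\<epsilon>>0. \<exists>\<delta>>0. \<forall>j t. \<bar>t\<bar> < \<delta> \<longrightarrow>
      norm (nth_deriv n f (l (Suc j) + t) - nth_deriv n f (l (Suc j)) -
        t *\<^sub>R nth_deriv (Suc n) f (l (Suc j))) \<le> \<epsilon> * \<bar>t\<bar>"
proof -
  have "(\<forall>j. nth_deriv n f differentiable (at (l (Suc j))) \<and>
      D (replicate (Suc n) (P (Suc j))) = scaleC_op (nth_deriv (Suc n) f (l (Suc j))) (P (Suc j))) \<and>
    (\<forall>\<epsilon>>0. \<exists>\<delta>>0. \<forall>j t. \<bar>t\<bar> < \<delta> \<longrightarrow>
      norm (nth_deriv n f (l (Suc j) + t) - nth_deriv n f (l (Suc j)) -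
        t *\<^sub>R nth_deriv (Suc n) f (l (Suc j))) \<le> \<epsilon> * \<bar>t\<bar>)"
    using assms(3)
  proof (induction n arbitrary: l D rule: less_induct)
    case (less n)
    from less.prems obtain G r where mult: "bounded_multilinear p (Suc n) D"
      and r: "r > 0" "\<And>X. X \<in> schatten_sa p \<Longrightarrow> schatten_norm p X < r \<Longrightarrow>
           has_frechet_derivative p f n (add_bounded (diag_real l) X) (G X)"
      and rem: "\<And>\<epsilon>. \<epsilon> > 0 \<Longrightarrow> \<exists>\<delta>>0. \<forall>X\<in>schatten_sa p. schatten_norm p X < \<delta> \<longrightarrow>
           (\<forall>Xs\<in>lists (schatten p). length Xs = n \<longrightarrow>
              (let R = (if n = 0 then op_increment f (diag_real l) X else G X Xs - G 0 Xs) - D (Xs @ [X])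
               in R \<in> schatten p \<and>
                  schatten_norm p R \<le> \<epsilon> * schatten_norm p X * prod_list (map (schatten_norm p) Xs)))"
      by (simp only: has_frechet_derivative.simps) blast
    define F where "F = nth_deriv n f"
    define D0 where "D0 j = D (replicate (Suc n) (P (Suc j)))" for j
    \<comment> \<open>Homogeneity in the last slot, where the definition places the new
      direction.\<close>
    have D_t: "D (replicate n (P (Suc j)) @ [t *\<^sub>R P (Suc j)]) = t *\<^sub>R D0 j" for j and t :: real
    proof -
      interpret rank_one "P (Suc j)" "e j"
        by (rule rank_one_P)
      have R: "P (Suc j) \<in> schatten p"
        using R_in_schatten_sa[of p] by (simp add: schatten_sa_def)
      define Xs where "Xs = replicate (Suc n) (P (Suc j))"
      have Xs: "Xs \<in> lists (schatten p)" "length Xs = Suc n"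
        using R by (auto simp: Xs_def)
      have upd: "Xs[n := U] = replicate n (P (Suc j)) @ [U]" for U
        by (simp add: Xs_def replicate_append_same[symmetric] list_update_append)
      have "D (Xs[n := scaleC_op (complex_of_real t) (P (Suc j))]) =
          scaleC_op (complex_of_real t) (D (Xs[n := P (Suc j)]))"
        using mult Xs R unfolding bounded_multilinear_def by blast
      moreover have "Xs[n := P (Suc j)] = Xs"
        by (simp add: upd) (simp add: Xs_def replicate_append_same)
      moreover have "scaleC_op (complex_of_real t) (D Xs) = t *\<^sub>R D Xs"
        by (rule blinfun_eqI) (simp add: scaleC_op.rep_eq scaleC_of_real blinfun.scaleR_left)
      ultimately show ?thesis
        unfolding upd scaleC_R_of_real D0_def Xs_def[symmetric] by (simp only:)
    qed
    have incr: "(if n = 0 then op_increment f (diag_real l) (t *\<^sub>R P (Suc j))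
        else G (t *\<^sub>R P (Suc j)) (replicate n (P (Suc j))) - G 0 (replicate n (P (Suc j)))) =
        scaleC_op (F (l (Suc j) + t) - F (l (Suc j))) (P (Suc j))" if t: "\<bar>t\<bar> < r" for j t
    proof (cases n)
      case 0
      then show ?thesis
        by (simp add: F_def op_increment_diag[OF f])
    next
      case (Suc m)
      interpret rank_one "P (Suc j)" "e j"
        by (rule rank_one_P)
      \<comment> \<open>The perturbation moves the eigenvalue to \<open>l (Suc j) + s\<close>; the
        induction hypothesis for the changed sequence evaluates \<open>G\<close>.\<close>
      have G: "G (s *\<^sub>R P (Suc j)) (replicate n (P (Suc j))) = scaleC_op (F (l (Suc j) + s)) (P (Suc j))"
        if "\<bar>s\<bar> < r" for s
      proof -
        have "has_frechet_derivative p f (Suc m)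
            (diag_real (l(Suc j := l (Suc j) + s))) (G (s *\<^sub>R P (Suc j)))"
          using r(2)[OF scaleR_R_in_schatten_sa, of s] that p
          by (simp only: schatten_norm_scaleR_R add_bounded_diag Suc)
        from less.IH[OF _ this] show ?thesis
          by (simp add: Suc F_def)
      qed
      show ?thesis
        using G[OF t] G[of 0] r(1) by (simp add: Suc scaleC_op_diff)
    qed
    have est: "\<exists>\<delta>>0. \<forall>j t. \<bar>t\<bar> < \<delta> \<longrightarrow>
        norm (scaleC_op (F (l (Suc j) + t) - F (l (Suc j))) (P (Suc j)) - t *\<^sub>R D0 j) \<le> \<epsilon> * \<bar>t\<bar>"
      if \<epsilon>: "\<epsilon> > 0" for \<epsilon>
    proof -
      from rem[OF \<epsilon>] obtain \<delta> where \<delta>: "\<delta> > 0" and *: "\<forall>X\<in>schatten_sa p. schatten_norm p X < \<delta> \<longrightarrow>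
           (\<forall>Xs\<in>lists (schatten p). length Xs = n \<longrightarrow>
              (let R = (if n = 0 then op_increment f (diag_real l) X else G X Xs - G 0 Xs) - D (Xs @ [X])
               in R \<in> schatten p \<and>
                  schatten_norm p R \<le> \<epsilon> * schatten_norm p X * prod_list (map (schatten_norm p) Xs)))"
        by blast
      \<comment> \<open>Below \<open>\<delta>\<close> the remainder estimate holds; below
        \<open>r\<close> the values of \<open>G\<close> are known through
        \<open>incr\<close>.\<close>
      have "norm (scaleC_op (F (l (Suc j) + t) - F (l (Suc j))) (P (Suc j)) - t *\<^sub>R D0 j) \<le> \<epsilon> * \<bar>t\<bar>"
        if t: "\<bar>t\<bar> < min \<delta> r" for j t
      proof -
        interpret rank_one "P (Suc j)" "e j"
          by (rule rank_one_P)
        define Rm where "Rm = scaleC_op (F (l (Suc j) + t) - F (l (Suc j))) (P (Suc j)) - t *\<^sub>R D0 j"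
        have "P (Suc j) \<in> schatten p"
          using R_in_schatten_sa[of p] by (simp add: schatten_sa_def)
        then have Xs: "replicate n (P (Suc j)) \<in> lists (schatten p)"
          by auto
        have norm_X: "schatten_norm p (t *\<^sub>R P (Suc j)) = \<bar>t\<bar>"
          using p by (rule schatten_norm_scaleR_R)
        then have small: "schatten_norm p (t *\<^sub>R P (Suc j)) < \<delta>"
          using t by simp
        have t_r: "\<bar>t\<bar> < r"
          using t by simp
        have "Rm \<in> schatten p \<and> schatten_norm p Rm \<le>
            \<epsilon> * \<bar>t\<bar> * prod_list (map (schatten_norm p) (replicate n (P (Suc j))))"
          using *[rule_format, OF scaleR_R_in_schatten_sa small Xs length_replicate]
          unfolding Let_def incr[OF t_r] D_t norm_X Rm_def .
        then have "Rm \<in> schatten p" "schatten_norm p Rm \<le> \<epsilon> * \<bar>t\<bar>"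
          using p by (simp_all add: schatten_norm_R)
        then show ?thesis
          using norm_le_schatten_norm[of Rm p] p by (simp add: Rm_def)
      qed
      then show ?thesis
        using \<delta> r(1) by (intro exI[of _ "min \<delta> r"]) auto
    qed
    have deriv: "nth_deriv n f differentiable (at (l (Suc j))) \<and>
        D0 j = scaleC_op (nth_deriv (Suc n) f (l (Suc j))) (P (Suc j))" for j
    proof -
      interpret rank_one "P (Suc j)" "e j"
        by (rule rank_one_P)
      define a where "a h = (1 / h) *\<^sub>R (F (l (Suc j) + h) - F (l (Suc j)))" for h
      have "((\<lambda>h. norm (scaleC_op (a h) (P (Suc j)) - D0 j)) \<longlongrightarrow> 0) (at 0)"
        unfolding LIM_eq
      proof (intro allI impI)
        fix \<epsilon> :: real assume "\<epsilon> > 0"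
        \<comment> \<open>Half of \<open>\<epsilon>\<close> is used so that the final bound is
          strict.\<close>
        then obtain \<delta> where \<delta>: "\<delta> > 0" "\<And>t. \<bar>t\<bar> < \<delta> \<Longrightarrow>
            norm (scaleC_op (F (l (Suc j) + t) - F (l (Suc j))) (P (Suc j)) - t *\<^sub>R D0 j) \<le> \<epsilon> / 2 * \<bar>t\<bar>"
          using est[of "\<epsilon> / 2"] by auto
        have "norm (scaleC_op (a h) (P (Suc j)) - D0 j) < \<epsilon>" if "h \<noteq> 0" "\<bar>h\<bar> < \<delta>" for h
        proof -
          have "scaleC_op (a h) (P (Suc j)) - D0 j =
              (1 / h) *\<^sub>R (scaleC_op (F (l (Suc j) + h) - F (l (Suc j))) (P (Suc j)) - h *\<^sub>R D0 j)"
            using that(1) by (simp add: a_def scaleR_diff_right scaleR_scaleC_R)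
          also have "norm \<dots> \<le> (1 / \<bar>h\<bar>) * (\<epsilon> / 2 * \<bar>h\<bar>)"
            unfolding norm_scaleR abs_divide abs_one by (intro mult_left_mono \<delta>(2) that(2)) simp
          also have "\<dots> < \<epsilon>"
            using that(1) \<open>\<epsilon> > 0\<close> by simp
          finally show ?thesis .
        qed
        then show "\<exists>\<delta>>0. \<forall>h. h \<noteq> 0 \<and> norm (h - 0) < \<delta> \<longrightarrow>
            norm (norm (scaleC_op (a h) (P (Suc j)) - D0 j) - 0) < \<epsilon>"
          using \<delta>(1) by auto
      qed
      from tendsto_scaleC_R[OF this] obtain d where "(a \<longlongrightarrow> d) (at 0)" "D0 j = scaleC_op d (P (Suc j))"
        by auto
      moreover from this have "(F has_vector_derivative d) (at (l (Suc j)))"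
        by (simp add: has_vector_derivative_iff_tendsto a_def[abs_def])
      ultimately show ?thesis
        by (auto simp: F_def nth_deriv_Suc vector_derivative_at differentiableI_vector)
    qed
    \<comment> \<open>Both terms are multiples of the same projection, so the operator norm is the
      modulus of the scalar remainder.\<close>
    have "norm (scaleC_op (F (l (Suc j) + t) - F (l (Suc j))) (P (Suc j)) - t *\<^sub>R D0 j) =
        norm (nth_deriv n f (l (Suc j) + t) - nth_deriv n f (l (Suc j)) -
          t *\<^sub>R nth_deriv (Suc n) f (l (Suc j)))" for j t
    proof -
      interpret rank_one "P (Suc j)" "e j"
        by (rule rank_one_P)
      show ?thesis
        using deriv[of j] by (simp only: scaleR_scaleC_R scaleC_op_diff[symmetric] norm_scaleC_R F_def)
    qed
    then show ?case
      using deriv est unfolding D0_def by simp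
  qed
  then show "\<forall>j. nth_deriv n f differentiable (at (l (Suc j))) \<and>
      D (replicate (Suc n) (P (Suc j))) = scaleC_op (nth_deriv (Suc n) f (l (Suc j))) (P (Suc j))"
    "\<forall>\<epsilon>>0. \<exists>\<delta>>0. \<forall>j t. \<bar>t\<bar> < \<delta> \<longrightarrow>
      norm (nth_deriv n f (l (Suc j) + t) - nth_deriv n f (l (Suc j)) -
        t *\<^sub>R nth_deriv (Suc n) f (l (Suc j))) \<le> \<epsilon> * \<bar>t\<bar>"
    by blast+
qed

end

section \<open>Consequences of Frechet differentiability for the function\<close>

context rank_one_resolution
begin

lemma frechet_differentiable_SucD:
  assumes "frechet_differentiable p f (Suc n) (diag_real l)" and p: "1 < p"
  shows "frechet_differentiable p f n (diag_real l)"
proof -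
  interpret rank_one "P (Suc 0)" "e 0"
    by (rule rank_one_P)
  obtain G r where r: "r > 0" and G: "\<And>X. X \<in> schatten_sa p \<Longrightarrow> schatten_norm p X < r \<Longrightarrow>
      has_frechet_derivative p f n (add_bounded (diag_real l) X) (G X)"
    using assms(1) unfolding frechet_differentiable_def has_frechet_derivative.simps by blast
  \<comment> \<open>The centre of the neighborhood is the perturbation by 0, written as a multiple
    of a projection so that \<open>add_bounded_diag\<close> applies.\<close>
  have "has_frechet_derivative p f n (add_bounded (diag_real l) (0 *\<^sub>R P (Suc 0))) (G (0 *\<^sub>R P (Suc 0)))"
    by (intro G scaleR_R_in_schatten_sa) (simp only: schatten_norm_scaleR_R p abs_zero r)
  then show ?thesis
    unfolding add_bounded_diag frechet_differentiable_def by auto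
qed

lemma frechet_differentiable_mono:
  assumes "frechet_differentiable p f n (diag_real l)" "k \<le> n" "1 < p"
  shows "frechet_differentiable p f k (diag_real l)"
  using assms(2,1)
proof (induction rule: inc_induct)
  case (step m)
  then show ?case
    using frechet_differentiable_SucD assms(3) by blast
qed

lemma differentiable_if_frechet:
  assumes f: "f \<in> borel_measurable borel" and p: "1 < p"
    and F: "frechet_differentiable p f n (diag_real l)" and k: "k < n"
  shows "nth_deriv k f differentiable (at (l (Suc j)))"
proof -
  have "frechet_differentiable p f (Suc k) (diag_real l)"
    using k by (intro frechet_differentiable_mono[OF F _ p]) simp
  then obtain D where "has_frechet_derivative p f (Suc k) (diag_real l) D"
    unfolding frechet_differentiable_def by blast
  from frechet_derivative_diag(1)[OF f p this] show ?thesis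
    by blast
qed

text \<open>For a convergent sequence of eigenvalues together with its limit, the estimate of the remainder
  is uniform, so the difference quotients of \<open>nth_deriv n f\<close> converge uniformly along the sequence.\<close>

lemma continuous_if_frechet:
  assumes f: "f \<in> borel_measurable borel" and p: "1 < p"
    and F: "\<And>A :: 'h operator. bounded_self_adjoint A \<Longrightarrow> frechet_differentiable p f (Suc n) A"
  shows "continuous_on UNIV (nth_deriv (Suc n) f)"
  unfolding continuous_on_sequentially comp_def
proof (intro allI ballI impI, elim conjE)
  fix u :: "nat \<Rightarrow> real" and x assume u: "u \<longlonglongrightarrow> x"
  define g where "g = nth_deriv n f"
  define g' where "g' = nth_deriv (Suc n) f"
  \<comment> \<open>The limit \<open>x\<close> is itself an eigenvalue, at index 1, so the uniform
    estimate covers it together with all \<open>u j\<close>. Index 0 belongs to the complement and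
    is filled with \<open>x\<close>.\<close>
  define l where "l i = (case i of 0 \<Rightarrow> x | Suc 0 \<Rightarrow> x | Suc (Suc j) \<Rightarrow> u j)" for i
  obtain K where K: "\<And>i. \<bar>u i\<bar> \<le> K"
    using convergent_imp_Bseq[OF convergentI[OF u]] by (auto simp: Bseq_def)
  have "\<bar>l i\<bar> \<le> max K \<bar>x\<bar>" for i
    using K by (auto simp: l_def max.coboundedI1 split: nat.split)
  then have fre: "frechet_differentiable p f (Suc n) (diag_real l)"
    by (intro F bounded_self_adjoint_diag)
  then obtain D where D: "has_frechet_derivative p f (Suc n) (diag_real l) D"
    unfolding frechet_differentiable_def by blast
  have diff: "g differentiable (at y)" for y
    using differentiable_if_frechet[OF f p F[OF bounded_self_adjoint_diag[of "\<lambda>_. y" "\<bar>y\<bar>"]], of n]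
    by (simp add: g_def)
  have cont: "isCont g y" for y
    using diff[of y] by (rule differentiable_imp_continuous_within)
  have "(\<lambda>i. g' (u i)) \<longlonglongrightarrow> g' x"
    unfolding LIMSEQ_iff
  proof (intro allI impI)
    fix \<epsilon> :: real assume "\<epsilon> > 0"
    \<comment> \<open>Four errors of size at most \<open>\<eta> * t\<close> are collected below; 5
      instead of 4 makes the bound strict.\<close>
    define \<eta> where "\<eta> = \<epsilon> / 5"
    have "\<eta> > 0"
      using \<open>\<epsilon> > 0\<close> by (simp add: \<eta>_def)
    then obtain \<delta> where \<delta>: "\<delta> > 0" and est: "\<And>j t. \<bar>t\<bar> < \<delta> \<Longrightarrow>
        norm (g (l (Suc j) + t) - g (l (Suc j)) - t *\<^sub>R g' (l (Suc j))) \<le> \<eta> * \<bar>t\<bar>"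
      using frechet_derivative_diag(2)[OF f p D] unfolding g_def g'_def by blast
    \<comment> \<open>The step \<open>t\<close> is fixed before \<open>i\<close> grows, so
      continuity of \<open>g\<close> at \<open>x\<close> and at \<open>x + t\<close> is what
      controls the first two errors.\<close>
    define t where "t = \<delta> / 2"
    have t: "t > 0" "\<bar>t\<bar> < \<delta>"
      using \<delta> by (simp_all add: t_def)
    have est_x: "norm (g (x + t) - g x - t *\<^sub>R g' x) \<le> \<eta> * t"
      using est[OF t(2), of 0] t(1) by (simp add: l_def)
    have est_u: "norm (g (u i + t) - g (u i) - t *\<^sub>R g' (u i)) \<le> \<eta> * t" for i
      using est[OF t(2), of "Suc i"] t(1) by (simp add: l_def)
    have "(\<lambda>i. g (u i + t)) \<longlonglongrightarrow> g (x + t)" "(\<lambda>i. g (u i)) \<longlonglongrightarrow> g x"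
      using u by (auto intro!: isCont_tendsto_compose[OF cont] tendsto_intros)
    then have "\<forall>\<^sub>F i in sequentially. dist (g (u i + t)) (g (x + t)) < \<eta> * t"
      "\<forall>\<^sub>F i in sequentially. dist (g (u i)) (g x) < \<eta> * t"
      using \<open>\<eta> > 0\<close> t(1) by - (rule tendstoD, assumption, simp)+
    then have "\<forall>\<^sub>F i in sequentially. norm (g' (u i) - g' x) < \<epsilon>"
    proof eventually_elim
      case (elim i)
      have "t *\<^sub>R (g' (u i) - g' x) = (g (u i + t) - g (x + t)) - (g (u i) - g x)
          - (g (u i + t) - g (u i) - t *\<^sub>R g' (u i)) + (g (x + t) - g x - t *\<^sub>R g' x)"
        by (simp add: algebra_simps)
      also have "norm \<dots> \<le> norm (g (u i + t) - g (x + t)) + norm (g (u i) - g x)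
          + norm (g (u i + t) - g (u i) - t *\<^sub>R g' (u i)) + norm (g (x + t) - g x - t *\<^sub>R g' x)"
        by (intro order_trans[OF norm_triangle_ineq] add_mono order_refl
            order_trans[OF norm_triangle_ineq4])
      also have "\<dots> \<le> 4 * (\<eta> * t)"
        using elim est_x est_u[of i] by (simp add: dist_norm)
      finally have "t * norm (g' (u i) - g' x) \<le> t * (4 * \<eta>)"
        using t(1) by (simp add: mult.commute)
      then have "norm (g' (u i) - g' x) \<le> 4 * \<eta>"
        using t(1) by (simp only: mult_le_cancel_left_pos)
      then show ?case
        using \<open>\<epsilon> > 0\<close> by (simp add: \<eta>_def)
    qed
    then show "\<exists>no. \<forall>i\<ge>no. norm (g' (u i) - g' x) < \<epsilon>"
      by (simp add: eventually_sequentially)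
  qed
  then show "(\<lambda>i. nth_deriv (Suc n) f (u i)) \<longlonglongrightarrow> nth_deriv (Suc n) f x"
    by (simp add: g'_def)
qed

end

text \<open>Measurability is the property of \<open>f\<close> that the functional calculus of
  diagonal operators asks for.\<close>

lemma locally_lipschitz_imp_borel_measurable:
  assumes "locally_lipschitz f"
  shows "f \<in> borel_measurable borel"
proof -
  have "isCont f x" for x
  proof -
    obtain u L where "u > 0" "L-lipschitz_on (cball x u) f"
      using assms unfolding locally_lipschitz_def by blast
    then show ?thesis
      by (intro continuous_on_interior[OF lipschitz_on_continuous_on]) auto
  qed
  then show ?thesis
    by (intro borel_measurable_continuous_onI continuous_at_imp_continuous_on) auto
qed

theorem proposition3p9:
  fixes f :: "real \<Rightarrow> complex" and p :: real and n :: nat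
  assumes infinite_dim: "\<not> (\<exists>B :: 'h::complex_hilbert_space set.
                              finite B \<and> complex_vector.span B = UNIV)"
    and separable: "\<exists>S :: 'h set. countable S \<and> closure S = UNIV"
    and f: "locally_lipschitz f"
    and p: "1 < p"
    and n: "1 \<le> n"
  shows
    "((\<forall>A :: 'h operator. bounded_self_adjoint A \<longrightarrow> gateaux_differentiable p f n A) \<longrightarrow>
        n_times_differentiable n f \<and>
        (\<forall>k\<in>{1..n}. \<forall>K. compact K \<longrightarrow> bounded (nth_deriv k f ` K))) \<and>
     ((\<exists>L. L-lipschitz_on UNIV f) \<and>
      (\<forall>A :: 'h operator. self_adjoint A \<longrightarrow> gateaux_differentiable p f n A) \<longrightarrow>
        (\<forall>k\<in>{1..n}. bounded (range (nth_deriv k f)))) \<and>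
     ((\<forall>A :: 'h operator. bounded_self_adjoint A \<longrightarrow> frechet_differentiable p f n A) \<longrightarrow>
        C_n n f)"
proof -
  obtain P :: "nat \<Rightarrow> 'h \<Rightarrow>\<^sub>L 'h" and e where "rank_one_resolution P e"
    using ex_rank_one_resolution[OF infinite_dim] by blast
  then interpret rank_one_resolution P e .
  have meas: "f \<in> borel_measurable borel"
    using f by (rule locally_lipschitz_imp_borel_measurable)
  have unbounded_sequence: "\<exists>l. (\<forall>i. l i \<in> K) \<and> \<not> (\<exists>C. \<forall>j. norm (nth_deriv k f (l (Suc j))) \<le> C)"
    if "\<not> bounded (nth_deriv k f ` K)" for k and K :: "real set"
  proof -
    have "\<forall>i::nat. \<exists>x\<in>K. norm (nth_deriv k f x) > real i"
      using that by (auto simp: bounded_iff not_le)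
    then obtain l where l: "\<And>i. l i \<in> K" "\<And>i. norm (nth_deriv k f (l i)) > real i"
      by metis
    have "\<not> (\<forall>j. norm (nth_deriv k f (l (Suc j))) \<le> C)" for C
    proof -
      obtain j :: nat where "C < real j"
        using reals_Archimedean2 by blast
      then have "C < norm (nth_deriv k f (l (Suc j)))"
        using l(2)[of "Suc j"] by simp
      then show ?thesis
        by (auto simp: not_le)
    qed
    then show ?thesis
      using l(1) by blast
  qed
  show ?thesis
  proof (intro conjI impI ballI allI)
    assume G: "\<forall>A :: 'h operator. bounded_self_adjoint A \<longrightarrow> gateaux_differentiable p f n A"
    show "n_times_differentiable n f"
      unfolding n_times_differentiable_def
    proof (intro allI impI)
      \<comment> \<open>The constant sequence gives \<open>x\<close> times the identity, a bounded
        operator with eigenvalue \<open>x\<close>.\<close>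
      fix k x assume "k < n"
      then show "nth_deriv k f differentiable (at x)"
        using differentiable_if_gateaux[OF meas p
            G[rule_format, OF bounded_self_adjoint_diag[of "\<lambda>_. x" "\<bar>x\<bar>"]]] by simp
    qed
    fix k K assume k: "k \<in> {1..n}" and "compact (K :: real set)"
    then obtain C where C: "\<And>x. x \<in> K \<Longrightarrow> \<bar>x\<bar> \<le> C"
      using compact_imp_bounded[of K] by (auto simp: bounded_iff)
    show "bounded (nth_deriv k f ` K)"
    proof (rule ccontr)
      assume "\<not> bounded (nth_deriv k f ` K)"
      then obtain l where l: "\<And>i. l i \<in> K" "\<not> (\<exists>C. \<forall>j. norm (nth_deriv k f (l (Suc j))) \<le> C)"
        using unbounded_sequence by blast
      have "gateaux_differentiable p f n (diag_real l)"
        using G bounded_self_adjoint_diag[of l C] C l(1) by blast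
      then show False
        using bounded_if_gateaux[OF meas p _ k] l(2) by blast
    qed
  next
    assume "(\<exists>L. L-lipschitz_on UNIV f) \<and>
      (\<forall>A :: 'h operator. self_adjoint A \<longrightarrow> gateaux_differentiable p f n A)"
    then have G: "gateaux_differentiable p f n (diag_real l)" for l
      using self_adjoint_diag by blast
    fix k assume "k \<in> {1..n}"
    then show "bounded (range (nth_deriv k f))"
      using unbounded_sequence[of k UNIV] bounded_if_gateaux[OF meas p G] by blast
  next
    assume F: "\<forall>A :: 'h operator. bounded_self_adjoint A \<longrightarrow> frechet_differentiable p f n A"
    have "n_times_differentiable n f"
      unfolding n_times_differentiable_def
    proof (intro allI impI)
      fix k x assume "k < n"
      then show "nth_deriv k f differentiable (at x)"
        using differentiable_if_frechet[OF meas p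
            F[rule_format, OF bounded_self_adjoint_diag[of "\<lambda>_. x" "\<bar>x\<bar>"]]] by simp
    qed
    moreover obtain m where "n = Suc m"
      using n by (cases n) auto
    ultimately show "C_n n f"
      unfolding C_n_def using continuous_if_frechet[OF meas p, of m] F by blast
  qed
qed

end
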